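(* The spaces $(\pi'_l,{\cal U}^+)$, $(\pi'_l,{\cal U}^-)$, $(\pi'_r,{\cal U}'^+)$ and $(\pi'_r,{\cal U}'^-)$ are irreducible representations of $\mathfrak{sl}(2,\mathbb H_{\mathbb C})$ (as well as of $\mathfrak{gl}(2,\mathbb H_{\mathbb C})$).
   Context: $\mathbb H_{\mathbb C}=\mathbb C\otimes_{\mathbb R}\mathbb H$ is identified with $2\times2$ complex matrices $Z=z^0e_0+z^1e_1+z^2e_2+z^3e_3$, $z^j\in\mathbb C$, with $e_0=1$, $e_1=\bigl(\begin{smallmatrix}0&-i\\-i&0\end{smallmatrix}\bigr)$, $e_2=\bigl(\begin{smallmatrix}0&-1\\1&0\end{smallmatrix}\bigr)$, $e_3=\bigl(\begin{smallmatrix}-i&0\\0&i\end{smallmatrix}\bigr)$; $N(Z)=\det Z$. $\mathfrak{gl}(2,\mathbb H_{\mathbb C})\simeq\mathfrak{gl}(4,\mathbb C)$, $\mathfrak{sl}(2,\mathbb H_{\mathbb C})\simeq\mathfrak{sl}(4,\mathbb C)$. $\mathbb S$, $\mathbb S'$ are the spaces of complex $2$-columns and $2$-rows. $\nabla=e_0\partial_{z^0}-e_1\partial_{z^1}-e_2\partial_{z^2}-e_3\partial_{z^3}$, $\square=\sum_j\partial_{z^j}^2$, $g\overleftarrow\nabla$ is $\nabla$ acting from the right. ${\cal U}=\{f\in\mathbb C[z^0,z^1,z^2,z^3,N(Z)^{-1}]\otimes\mathbb S;\nabla\square f=0\}$, ${\cal U}'=\{g\in\mathbb C[z^0,z^1,z^2,z^3,N(Z)^{-1}]\otimes\mathbb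 S';(\square g)\overleftarrow\nabla=0\}$. ${\cal U}^+$, ${\cal U}'^+$ (resp. ${\cal U}^-$, ${\cal U}'^-$) are the spans of the homogeneous elements of degree $\ge0$ (resp. $<0$) of ${\cal U}$, ${\cal U}'$. The Lie algebra acts on ${\cal U}$ and ${\cal U}'$ by differentiating $(\pi'_l(h)f)(Z)=\frac{a'-Zc'}{N(a'-Zc')}f\bigl((a'-Zc')^{-1}(-b'+Zd')\bigr)$ and $(\pi'_r(h)g)(Z)=g\bigl((aZ+b)(cZ+d)^{-1}\bigr)\frac{cZ+d}{N(cZ+d)}$, where $h=\bigl(\begin{smallmatrix}a'&b'\\c'&d'\end{smallmatrix}\bigr)\in GL(2,\mathbb H_{\mathbb C})$, $h^{-1}=\bigl(\begin{smallmatrix}a&b\\c&d\end{smallmatrix}\bigr)$. *)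

theory Defs
  imports "HOL-Analysis.Analysis" "HOL-Library.Function_Algebras"
begin

section \<open>Complexified quaternions\<close>

type_synonym hc = "complex^2^2"

definition msc :: "complex \<Rightarrow> complex^'n^'m \<Rightarrow> complex^'n^'m"
  where "msc c A = (\<chi> i j. c * A $ i $ j)"

definition qe :: "nat \<Rightarrow> hc" where
  "qe j = [ mat 1,
            vector [vector [0, -\<i>], vector [-\<i>, 0]],
            vector [vector [0, -1], vector [1, 0]],
            vector [vector [-\<i>, 0], vector [0, \<i>]] ] ! j"

abbreviation qnorm :: "hc \<Rightarrow> complex" where "qnorm Z \<equiv> det Z"

text \<open>The coordinates \<open>z^0, \<dots>, z^3\<close> with respect to the basis \<^const>\<open>qe\<close>;
  see the two lemmas below.\<close>

definition coord :: "nat \<Rightarrow> hc \<Rightarrow> complex" where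
  "coord j Z = [ (Z$1$1 + Z$2$2) / 2,
                 \<i> * (Z$1$2 + Z$2$1) / 2,
                 (Z$2$1 - Z$1$2) / 2,
                 \<i> * (Z$1$1 - Z$2$2) / 2 ] ! j"

lemma coord_expansion: "Z = (\<Sum>j<4. msc (coord j Z) (qe j))"
  by (simp add: eval_nat_numeral vec_eq_iff forall_2 qe_def coord_def msc_def mat_def field_simps)

lemma coord_unique:
  assumes "i < 4" shows "coord i (\<Sum>j<4. msc (c j) (qe j)) = c i"
proof -
  have "i = 0 \<or> i = 1 \<or> i = 2 \<or> i = 3" using assms by auto
  then show ?thesis
    by (auto simp: eval_nat_numeral qe_def coord_def msc_def mat_def field_simps)
qed

section \<open>Functions on the invertible elements\<close>

inductive_set poly_funs :: "(hc \<Rightarrow> complex) set" where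
  const: "(\<lambda>Z. c) \<in> poly_funs"
| coord: "j < 4 \<Longrightarrow> coord j \<in> poly_funs"
| add: "p \<in> poly_funs \<Longrightarrow> q \<in> poly_funs \<Longrightarrow> (\<lambda>Z. p Z + q Z) \<in> poly_funs"
| mult: "p \<in> poly_funs \<Longrightarrow> q \<in> poly_funs \<Longrightarrow> (\<lambda>Z. p Z * q Z) \<in> poly_funs"

text \<open>The ring \<open>\<complex>[z^0, z^1, z^2, z^3, N(Z)^{-1}]\<close>, realised as functions on the domain
  \<open>N(Z) \<noteq> 0\<close>. Functions on this domain are represented by total functions that
  vanish where \<open>N(Z) = 0\<close>, so that equality of HOL functions is equality on the domain.\<close>

definition laurent_funs :: "(hc \<Rightarrow> complex) set" where
  "laurent_funs =
     {f. \<exists>p\<in>poly_funs. \<exists>k::nat. \<forall>Z. f Z = (if qnorm Z = 0 then 0 else p Z / qnorm Z ^ k)}"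

text \<open>Both the columns \<open>\<bbbS>\<close> and the rows \<open>\<bbbS>'\<close> are of type \<^typ>\<open>complex^2\<close>;
  matrices act on columns by \<open>*v\<close> from the left and on rows by \<open>v*\<close> from the right.\<close>

type_synonym hfun = "hc \<Rightarrow> complex^2"

definition fscale :: "complex \<Rightarrow> hfun \<Rightarrow> hfun"
  where "fscale c f = (\<lambda>Z. c *s f Z)"

interpretation hfun: vector_space fscale
  by unfold_locales (auto simp: fscale_def fun_eq_iff vec_eq_iff algebra_simps)

definition pd :: "nat \<Rightarrow> hfun \<Rightarrow> hfun" where
  "pd j f = (\<lambda>Z. \<chi> i. deriv (\<lambda>t. f (Z + msc t (qe j)) $ i) 0)"

definition box :: "hfun \<Rightarrow> hfun" where
  "box f = (\<lambda>Z. \<Sum>j<4. pd j (pd j f) Z)"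

definition nabla :: "hfun \<Rightarrow> hfun" where
  "nabla f = (\<lambda>Z. qe 0 *v pd 0 f Z - qe 1 *v pd 1 f Z - qe 2 *v pd 2 f Z - qe 3 *v pd 3 f Z)"

definition nabla_right :: "hfun \<Rightarrow> hfun" where
  "nabla_right g = (\<lambda>Z. pd 0 g Z v* qe 0 - pd 1 g Z v* qe 1 - pd 2 g Z v* qe 2 - pd 3 g Z v* qe 3)"

definition U_left :: "hfun set" where
  "U_left = {f. (\<forall>i. (\<lambda>Z. f Z $ i) \<in> laurent_funs) \<and>
                (\<forall>Z. qnorm Z \<noteq> 0 \<longrightarrow> nabla (box f) Z = 0)}"

definition U_right :: "hfun set" where
  "U_right = {g. (\<forall>i. (\<lambda>Z. g Z $ i) \<in> laurent_funs) \<and>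
                 (\<forall>Z. qnorm Z \<noteq> 0 \<longrightarrow> nabla_right (box g) Z = 0)}"

definition homogeneous :: "int \<Rightarrow> hfun \<Rightarrow> bool" where
  "homogeneous d f \<longleftrightarrow> (\<forall>c Z. c \<noteq> 0 \<longrightarrow> f (msc c Z) = (c powi d) *s f Z)"

definition nonneg_part :: "hfun set \<Rightarrow> hfun set" where
  "nonneg_part U = hfun.span {f \<in> U. \<exists>d\<ge>0. homogeneous d f}"

definition neg_part :: "hfun set \<Rightarrow> hfun set" where
  "neg_part U = hfun.span {f \<in> U. \<exists>d<0. homogeneous d f}"

section \<open>The actions\<close>

text \<open>Block matrices over \<^typ>\<open>hc\<close>: a row or column index \<open>(i, k)\<close> consists of the
  block index \<open>i\<close> and the index \<open>k\<close> inside the block.\<close>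

type_synonym glh = "complex^(2 \<times> 2)^(2 \<times> 2)"

definition blk :: "2 \<Rightarrow> 2 \<Rightarrow> glh \<Rightarrow> hc" where
  "blk i j h = (\<chi> k l. h $ (i, k) $ (j, l))"

definition pi_left :: "glh \<Rightarrow> hfun \<Rightarrow> hfun" where
  "pi_left h f = (\<lambda>Z.
     let a' = blk 1 1 h; b' = blk 1 2 h; c' = blk 2 1 h; d' = blk 2 2 h;
         D = a' - Z ** c'
     in msc (1 / qnorm D) D *v f (matrix_inv D ** (- b' + Z ** d')))"

definition pi_right :: "glh \<Rightarrow> hfun \<Rightarrow> hfun" where
  "pi_right h g = (\<lambda>Z.
     let h' = matrix_inv h;
         a = blk 1 1 h'; b = blk 1 2 h'; c = blk 2 1 h'; d = blk 2 2 h';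
         D = c ** Z + d
     in g ((a ** Z + b) ** matrix_inv D) v* msc (1 / qnorm D) D)"

text \<open>The differential at the identity, in direction \<open>X\<close>, of \<open>h \<mapsto> (\<pi>(h) f)(Z)\<close>.
  For fixed \<open>Z\<close> with \<open>N(Z) \<noteq> 0\<close> this map is defined for all \<open>h\<close> near the identity.\<close>

definition differential :: "(glh \<Rightarrow> hfun \<Rightarrow> hfun) \<Rightarrow> glh \<Rightarrow> hfun \<Rightarrow> hfun" where
  "differential \<pi> X f =
     (\<lambda>Z. if qnorm Z = 0 then 0 else frechet_derivative (\<lambda>h. \<pi> h f Z) (at (mat 1)) X)"

definition gl :: "glh set" where "gl = UNIV"
definition sl :: "glh set" where "sl = {X. trace X = 0}"

section \<open>Irreducible representations of Lie algebras of matrices\<close>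

definition lie_rep :: "(complex^'n^'n) set \<Rightarrow> (complex^'n^'n \<Rightarrow> hfun \<Rightarrow> hfun) \<Rightarrow> hfun set \<Rightarrow> bool" where
  "lie_rep L \<rho> V \<longleftrightarrow>
     hfun.subspace V \<and>
     (\<forall>X\<in>L. \<forall>f\<in>V. \<rho> X f \<in> V) \<and>
     (\<forall>X\<in>L. \<forall>f\<in>V. \<forall>g\<in>V. \<rho> X (f + g) = \<rho> X f + \<rho> X g) \<and>
     (\<forall>X\<in>L. \<forall>c. \<forall>f\<in>V. \<rho> X (fscale c f) = fscale c (\<rho> X f)) \<and>
     (\<forall>X\<in>L. \<forall>Y\<in>L. \<forall>f\<in>V. \<rho> (X + Y) f = \<rho> X f + \<rho> Y f) \<and>
     (\<forall>c. \<forall>X\<in>L. \<forall>f\<in>V. \<rho> (msc c X) f = fscale c (\<rho> X f)) \<and>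
     (\<forall>X\<in>L. \<forall>Y\<in>L. \<forall>f\<in>V. \<rho> (X ** Y - Y ** X) f = \<rho> X (\<rho> Y f) - \<rho> Y (\<rho> X f))"

definition irreducible_lie_rep ::
    "(complex^'n^'n) set \<Rightarrow> (complex^'n^'n \<Rightarrow> hfun \<Rightarrow> hfun) \<Rightarrow> hfun set \<Rightarrow> bool" where
  "irreducible_lie_rep L \<rho> V \<longleftrightarrow>
     lie_rep L \<rho> V \<and> V \<noteq> {0} \<and>
     (\<forall>W. hfun.subspace W \<and> W \<subseteq> V \<and> (\<forall>X\<in>L. \<forall>f\<in>W. \<rho> X f \<in> W) \<longrightarrow> W = {0} \<or> W = V)"

end

theory Submission
  imports Defs
begin

text \<open>
  Laurent functions form a commutative ring with four commuting derivations, one for each entry of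
  \<open>Z\<close>. In this ring the equation \<open>\<nabla>\<box>f = 0\<close> is algebraic, homogeneity is Euler's equation, and the
  differentiated action is a first-order operator: the block \<open>b'\<close> acts by derivations and lowers
  the degree by one, the block \<open>c'\<close> acts by quadratic vector fields and raises it by one, and the
  diagonal blocks preserve it. The operator \<open>\<nabla>\<box>\<close> is covariant under all of them
  (\<open>nabla_box_conformal\<close> is the essential case), so they preserve the space of solutions.

  The solutions of degree \<open>0\<close> are the constants (\<open>graded_0_constant\<close>) and those of degree \<open>-1\<close>
  are the columns \<open>Z k / N(Z)\<close> (\<open>graded_neg1_Zcol\<close>). The former are annihilated by lowering, the
  latter by raising. This is why the parts of nonnegative and of negative degree are separately stable.
  Both descriptions come from one observation on harmonic Laurent functions: for \<open>\<box>f = 0\<close> and \<open>f\<close>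
  of degree \<open>n\<close>, \<open>\<box>(N^(k+1) f)\<close> is a multiple of \<open>N^k f\<close> with factor \<open>4 (k + 1) (k + 2 + n)\<close>,
  so unless this factor vanishes a denominator can be removed (\<open>harmonic_clear\<close>). In degree \<open>-1\<close>
  nothing is left, in degree \<open>0\<close> only constants, in degree \<open>-2\<close> only multiples of \<open>1/N\<close>.

  Let \<open>W\<close> be a nonzero invariant subspace of the part of nonnegative degree. The block matrix
  \<open>diag(1, -1)\<close> acts through the Euler operator, so \<open>W\<close> contains the homogeneous components of its
  elements. Lowering a nonzero component repeatedly ends in a nonzero constant, and the trace-zero
  matrices in the upper left block generate all constants from it. To climb up again, consider the sum \<open>T\<close>
  over dual bases of lowering followed by raising. On a solution \<open>f\<close> of degree \<open>n\<close> it is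
  \<open>T f = n\<^sup>2 f - 2 u - v\<close>, where \<open>u = N \<box>f / 4\<close> and \<open>v = Z \<nabla>f / 2\<close> are solutions of degree
  \<open>n\<close> as well, with
  \<open>T u = (n\<^sup>2 - 2 n - 1) u\<close> and \<open>T v = (n\<^sup>2 - n - 1) v - u\<close> (\<open>lower_raise_graded\<close>). The two
  quadratics have no integer zeros. So for \<open>n \<noteq> 0\<close> the solution \<open>f\<close> is a combination of \<open>T f\<close>,
  \<open>T u\<close> and \<open>T v\<close>, each obtained by raising solutions of degree \<open>n - 1\<close>, and by
  induction on the degree \<open>W\<close> contains all solutions of nonnegative degree. In negative degrees the roles of raising and lowering are
  exchanged, with diagonal entries \<open>n\<^sup>2 + 4 n + 2\<close>, \<open>(n + 1)\<^sup>2\<close> and \<open>n\<^sup>2 + 3 n + 1\<close>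
  (\<open>raise_lower_graded\<close>).

  Only matrices of trace zero were used, so the argument covers both Lie algebras. The right action is
  carried to the left action by \<open>Z \<mapsto> Z\<^sup>T\<close> together with an automorphism of the Lie algebra
  (\<open>differential_pi_right\<close>).
\<close>

section \<open>Laurent functions and their gradients\<close>

lemma poly_funs_uminus: "p \<in> poly_funs \<Longrightarrow> (\<lambda>Z. - p Z) \<in> poly_funs"
  using poly_funs.mult[OF poly_funs.const[of "-1"]] by simp

lemma poly_funs_diff: "p \<in> poly_funs \<Longrightarrow> q \<in> poly_funs \<Longrightarrow> (\<lambda>Z. p Z - q Z) \<in> poly_funs"
  using poly_funs.add[OF _ poly_funs_uminus] by simp

lemma poly_funs_entry: "(\<lambda>Z. Z $ a $ b) \<in> poly_funs"
proof -
  have c: "(\<lambda>Z. coord i Z + \<i> * coord j Z * s) \<in> poly_funs"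
    "(\<lambda>Z. - \<i> * coord i Z + coord j Z * s) \<in> poly_funs" if "i < 4" "j < 4" for i j s
    using that by (intro poly_funs.intros; simp)+
  have e: "(\<lambda>Z. Z $ 1 $ 1) = (\<lambda>Z. coord 0 Z + \<i> * coord 3 Z * (-1))"
     "(\<lambda>Z. Z $ 2 $ 2) = (\<lambda>Z. coord 0 Z + \<i> * coord 3 Z * 1)"
     "(\<lambda>Z. Z $ 1 $ 2) = (\<lambda>Z. - \<i> * coord 1 Z + coord 2 Z * (-1))"
     "(\<lambda>Z. Z $ 2 $ 1) = (\<lambda>Z. - \<i> * coord 1 Z + coord 2 Z * 1)"
    by (auto simp: coord_def fun_eq_iff field_simps)
  consider "a = 1" "b = 1" | "a = 1" "b = 2" | "a = 2" "b = 1" | "a = 2" "b = 2"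
    using exhaust_2 by metis
  then show ?thesis
    by cases (simp_all only: e; rule c; simp)+
qed

lemma poly_funs_power: "p \<in> poly_funs \<Longrightarrow> (\<lambda>Z. p Z ^ n) \<in> poly_funs"
  by (induction n) (auto intro: poly_funs.intros)

lemma poly_funs_qnorm: "(\<lambda>Z. qnorm Z) \<in> poly_funs"
  unfolding det_2 by (intro poly_funs_diff poly_funs.mult poly_funs_entry)

text \<open>Derivatives are taken with respect to the four matrix entries, because the vector fields of
  the action have polynomial coefficients with few terms in these coordinates.\<close>

abbreviation has_gradient :: "(hc \<Rightarrow> complex) \<Rightarrow> (2 \<Rightarrow> 2 \<Rightarrow> complex) \<Rightarrow> hc \<Rightarrow> bool" where
  "has_gradient f q Z \<equiv> (f has_derivative (\<lambda>V. \<Sum>a\<in>UNIV. \<Sum>b\<in>UNIV. V $ a $ b * q a b)) (at Z)"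

lemma has_derivative_entry: "((\<lambda>Z::complex^'n^'m. Z $ a $ b) has_derivative (\<lambda>V. V $ a $ b)) F"
  by (intro bounded_linear_imp_has_derivative bounded_linear_compose[OF bounded_linear_vec_nth] bounded_linear_vec_nth)

lemma poly_funs_has_gradient:
  assumes "p \<in> poly_funs"
  shows "\<exists>q. (\<forall>a b. q a b \<in> poly_funs) \<and> (\<forall>Z. has_gradient p (\<lambda>a b. q a b Z) Z)"
  using assms
proof induction
  case (const c)
  show ?case by (rule exI[of _ "\<lambda>a b Z. 0"]) (auto intro: poly_funs.intros)
next
  case (coord j)
  define q :: "2 \<Rightarrow> 2 \<Rightarrow> complex" where "q = (\<lambda>a b.
      if j = 0 then if a = b then 1/2 else 0
      else if j = 1 then if a = b then 0 else \<i>/2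
      else if j = 2 then if a = b then 0 else if a = 1 then -1/2 else 1/2
      else if a \<noteq> b then 0 else if a = 1 then \<i>/2 else -\<i>/2)"
  have "j = 0 \<or> j = 1 \<or> j = 2 \<or> j = 3" using coord by linarith
  then have c: "coord j = (\<lambda>V. \<Sum>a\<in>UNIV. \<Sum>b\<in>UNIV. V $ a $ b * q a b)"
    by (elim disjE) (simp_all add: q_def coord_def fun_eq_iff sum_2 field_simps)
  show ?case unfolding c
    by (rule exI[of _ "\<lambda>a b Z. q a b"])
      (intro conjI allI poly_funs.const has_derivative_sum has_derivative_mult_left has_derivative_entry)
next
  case (add p q)
  then obtain p' q' where p: "\<forall>a b. p' a b \<in> poly_funs" "\<forall>Z. has_gradient p (\<lambda>a b. p' a b Z) Z"
    and q: "\<forall>a b. q' a b \<in> poly_funs" "\<forall>Z. has_gradient q (\<lambda>a b. q' a b Z) Z" by auto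
  show ?case
    by (rule exI[of _ "\<lambda>a b Z. p' a b Z + q' a b Z"])
      (use p q in \<open>auto intro!: poly_funs.intros derivative_eq_intros simp: algebra_simps sum.distrib\<close>)
next
  case (mult p q)
  then obtain p' q' where p: "\<forall>a b. p' a b \<in> poly_funs" "\<forall>Z. has_gradient p (\<lambda>a b. p' a b Z) Z"
    and q: "\<forall>a b. q' a b \<in> poly_funs" "\<forall>Z. has_gradient q (\<lambda>a b. q' a b Z) Z" by auto
  show ?case
    by (rule exI[of _ "\<lambda>a b Z. p Z * q' a b Z + p' a b Z * q Z"])
      (use p q mult in \<open>auto intro!: poly_funs.intros derivative_eq_intros
         simp: algebra_simps sum.distrib sum_distrib_left sum_distrib_right\<close>)
qed

lemma continuous_qnorm: "continuous_on UNIV (\<lambda>Z::hc. qnorm Z)"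
  unfolding det_2 by (intro continuous_intros)

lemma open_invertibles: "open {Z::hc. qnorm Z \<noteq> 0}"
  by (intro open_Collect_neq continuous_qnorm continuous_on_const)

lemma laurent_funsI:
  assumes "p \<in> poly_funs" "\<And>Z. f Z = (if qnorm Z = 0 then 0 else p Z / qnorm Z ^ k)"
  shows "f \<in> laurent_funs"
  unfolding laurent_funs_def using assms by auto

text \<open>The quotient rule keeps the derivatives of \<open>p / N^k\<close> inside the class: its numerator becomes
  \<open>N \<partial>p - k p \<partial>N\<close> over \<open>N^(k+1)\<close>.\<close>

lemma laurent_funs_has_gradient:
  assumes "f \<in> laurent_funs"
  shows "\<exists>q. (\<forall>a b. q a b \<in> laurent_funs) \<and> (\<forall>Z. qnorm Z \<noteq> 0 \<longrightarrow> has_gradient f (\<lambda>a b. q a b Z) Z)"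
proof -
  from assms obtain p k where p: "p \<in> poly_funs" and f: "\<And>Z. f Z = (if qnorm Z = 0 then 0 else p Z / qnorm Z ^ k)"
    unfolding laurent_funs_def by auto
  obtain p' where p': "\<forall>a b. p' a b \<in> poly_funs" "\<forall>Z. has_gradient p (\<lambda>a b. p' a b Z) Z"
    using poly_funs_has_gradient[OF p] by auto
  obtain n' where n': "\<forall>a b. n' a b \<in> poly_funs" "\<forall>Z. has_gradient qnorm (\<lambda>a b. n' a b Z) Z"
    using poly_funs_has_gradient[OF poly_funs_qnorm] by auto
  let ?q = "\<lambda>a b Z. qnorm Z * p' a b Z - of_nat k * (p Z * n' a b Z)"
  have q: "?q a b \<in> poly_funs" for a b
    using p p' n' by (intro poly_funs_diff poly_funs.mult poly_funs_qnorm poly_funs.const) auto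
  show ?thesis
  proof (intro exI[of _ "\<lambda>a b Z. if qnorm Z = 0 then 0 else ?q a b Z / qnorm Z ^ (k + 1)"] conjI allI impI)
    fix a b show "(\<lambda>Z. if qnorm Z = 0 then 0 else ?q a b Z / qnorm Z ^ (k + 1)) \<in> laurent_funs"
      by (rule laurent_funsI[OF q]) (rule refl)
  next
    fix Z :: hc assume Z: "qnorm Z \<noteq> 0"
    have pw: "((\<lambda>Z. qnorm Z ^ k) has_derivative
        (\<lambda>V. of_nat k * (\<Sum>a\<in>UNIV. \<Sum>b\<in>UNIV. V $ a $ b * n' a b Z) * qnorm Z ^ (k - 1))) (at Z)"
      using has_derivative_power[OF n'(2)[rule_format], of k Z] by (simp add: mult_ac)
    have "((\<lambda>Z. p Z / qnorm Z ^ k) has_derivative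
       (\<lambda>V. - p Z * (inverse (qnorm Z ^ k) * (of_nat k * (\<Sum>a\<in>UNIV. \<Sum>b\<in>UNIV. V $ a $ b * n' a b Z) * qnorm Z ^ (k - 1)) * inverse (qnorm Z ^ k))
          + (\<Sum>a\<in>UNIV. \<Sum>b\<in>UNIV. V $ a $ b * p' a b Z) / qnorm Z ^ k)) (at Z)"
      using p'(2) Z by (intro has_derivative_divide pw) auto
    moreover have "- p Z * (inverse (qnorm Z ^ k) * (of_nat k * (\<Sum>a\<in>UNIV. \<Sum>b\<in>UNIV. V $ a $ b * n' a b Z) * qnorm Z ^ (k - 1)) * inverse (qnorm Z ^ k))
          + (\<Sum>a\<in>UNIV. \<Sum>b\<in>UNIV. V $ a $ b * p' a b Z) / qnorm Z ^ k
        = (\<Sum>a\<in>UNIV. \<Sum>b\<in>UNIV. V $ a $ b * (?q a b Z / qnorm Z ^ (k + 1)))" (is "?l = ?r") for V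
    proof -
      define S where "S = (\<Sum>a\<in>UNIV. \<Sum>b\<in>UNIV. V $ a $ b * n' a b Z)"
      define T where "T = (\<Sum>a\<in>UNIV. \<Sum>b\<in>UNIV. V $ a $ b * p' a b Z)"
      have "?r = (\<Sum>a\<in>UNIV. \<Sum>b\<in>UNIV. V $ a $ b * ?q a b Z) / qnorm Z ^ (k + 1)"
        by (simp add: sum_divide_distrib)
      also have "(\<Sum>a\<in>UNIV. \<Sum>b\<in>UNIV. V $ a $ b * ?q a b Z) = qnorm Z * T - of_nat k * p Z * S"
        unfolding S_def T_def sum_2 by (simp add: algebra_simps)
      also have "(qnorm Z * T - of_nat k * p Z * S) / qnorm Z ^ (k + 1) = ?l"
        unfolding S_def[symmetric] T_def[symmetric] using Z by (cases k) (simp_all add: divide_simps)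
      finally show ?thesis by simp
    qed
    ultimately have "has_gradient (\<lambda>Z. p Z / qnorm Z ^ k) (\<lambda>a b. ?q a b Z / qnorm Z ^ (k + 1)) Z"
      by (rule has_derivative_eq_rhs[OF _ ext])
    then have "has_gradient f (\<lambda>a b. ?q a b Z / qnorm Z ^ (k + 1)) Z"
      by (rule has_derivative_transform_within_open[OF _ open_invertibles]) (auto simp: f Z)
    then show "has_gradient f (\<lambda>a b. if qnorm Z = 0 then 0 else ?q a b Z / qnorm Z ^ (k + 1)) Z"
      using Z by simp
  qed
qed

lemma laurent_funs_closed:
  assumes "f \<in> laurent_funs" "g \<in> laurent_funs"
  shows "(\<lambda>Z. f Z + g Z) \<in> laurent_funs" "(\<lambda>Z. f Z * g Z) \<in> laurent_funs"
proof -
  from assms obtain p k q l where p: "p \<in> poly_funs" and f: "\<And>Z. f Z = (if qnorm Z = 0 then 0 else p Z / qnorm Z ^ k)"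
   and q: "q \<in> poly_funs" and g: "\<And>Z. g Z = (if qnorm Z = 0 then 0 else q Z / qnorm Z ^ l)"
    unfolding laurent_funs_def by auto
  have "f Z + g Z = (if qnorm Z = 0 then 0 else (p Z * qnorm Z ^ l + q Z * qnorm Z ^ k) / qnorm Z ^ (k + l))" for Z
    by (simp add: f g power_add add_frac_eq)
  moreover have "(\<lambda>Z. p Z * qnorm Z ^ l + q Z * qnorm Z ^ k) \<in> poly_funs"
    by (intro poly_funs.intros p q poly_funs_power poly_funs_qnorm)
  ultimately show "(\<lambda>Z. f Z + g Z) \<in> laurent_funs"
    by (intro laurent_funsI)
  have "f Z * g Z = (if qnorm Z = 0 then 0 else (p Z * q Z) / qnorm Z ^ (k + l))" for Z
    by (simp add: f g power_add)
  moreover have "(\<lambda>Z. p Z * q Z) \<in> poly_funs"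
    by (intro poly_funs.intros p q)
  ultimately show "(\<lambda>Z. f Z * g Z) \<in> laurent_funs"
    by (intro laurent_funsI)
qed

lemma laurent_funs_cut:
  assumes "p \<in> poly_funs"
  shows "(\<lambda>Z. if qnorm Z = 0 then 0 else p Z) \<in> laurent_funs"
  by (rule laurent_funsI[OF assms, of _ 0]) simp

lemma laurent_funs_inverse_qnorm: "(\<lambda>Z. if qnorm Z = 0 then 0 else 1 / qnorm Z) \<in> laurent_funs"
  by (rule laurent_funsI[OF poly_funs.const[of 1], of _ 1]) simp

lemma laurent_funs_uminus:
  assumes "f \<in> laurent_funs"
  shows "(\<lambda>Z. - f Z) \<in> laurent_funs"
proof -
  have "(\<lambda>Z. (if qnorm Z = 0 then 0 else -1) * f Z) = (\<lambda>Z. - f Z)"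
    using assms unfolding laurent_funs_def by auto
  then show ?thesis
    using laurent_funs_closed(2)[OF laurent_funs_cut[OF poly_funs.const[of "-1"]] assms] by simp
qed

lemma laurent_funs_vanish: "f \<in> laurent_funs \<Longrightarrow> qnorm Z = 0 \<Longrightarrow> f Z = 0"
  unfolding laurent_funs_def by auto

definition unit_mat :: "2 \<Rightarrow> 2 \<Rightarrow> hc" where
  "unit_mat a b = (\<chi> i j. if i = a \<and> j = b then 1 else 0)"

text \<open>The value \<open>0\<close> on the singular matrices makes the partial derivative of a Laurent function
  an element of the same set, in which functions vanish there.\<close>

definition partial :: "2 \<Rightarrow> 2 \<Rightarrow> (hc \<Rightarrow> complex) \<Rightarrow> hc \<Rightarrow> complex" where
  "partial a b f Z = (if qnorm Z = 0 then 0 else frechet_derivative f (at Z) (unit_mat a b))"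

lemma partial_eq:
  assumes "has_gradient f q Z" "qnorm Z \<noteq> 0"
  shows "partial a b f Z = q a b"
proof -
  have "(\<Sum>i\<in>UNIV. \<Sum>j\<in>UNIV. unit_mat a b $ i $ j * q i j) = q a b"
    using exhaust_2[of a] exhaust_2[of b] by (auto simp: unit_mat_def sum_2)
  then show ?thesis
    using assms(2) unfolding partial_def frechet_derivative_at[OF assms(1), symmetric] by simp
qed

lemma laurent_funs_partial:
  assumes "f \<in> laurent_funs"
  shows "partial a b f \<in> laurent_funs"
proof -
  obtain q where q: "\<forall>a b. q a b \<in> laurent_funs" "\<forall>Z. qnorm Z \<noteq> 0 \<longrightarrow> has_gradient f (\<lambda>a b. q a b Z) Z"
    using laurent_funs_has_gradient[OF assms] by blast
  have "partial a b f = q a b"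
  proof
    fix Z show "partial a b f Z = q a b Z"
      using partial_eq[OF q(2)[rule_format], of Z] laurent_funs_vanish[OF q(1)[rule_format]]
      by (cases "qnorm Z = 0") (auto simp: partial_def)
  qed
  then show ?thesis using q by simp
qed

lemma has_gradient_partial:
  assumes "f \<in> laurent_funs" "qnorm Z \<noteq> 0"
  shows "has_gradient f (\<lambda>a b. partial a b f Z) Z"
proof -
  obtain q where "\<forall>Z. qnorm Z \<noteq> 0 \<longrightarrow> has_gradient f (\<lambda>a b. q a b Z) Z"
    using laurent_funs_has_gradient[OF assms(1)] by blast
  then have q: "has_gradient f (\<lambda>a b. q a b Z) Z" using assms(2) by blast
  show ?thesis unfolding partial_eq[OF q assms(2)] by (rule q)
qed

section \<open>The ring of Laurent functions and its commuting derivations\<close>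

text \<open>Making the Laurent functions a type of their own turns the partial derivatives into total
  derivations of a commutative ring. Differential identities then become ring identities that
  rewriting can decide, without side conditions on differentiability or on \<open>N(Z) \<noteq> 0\<close>.\<close>

typedef laurent = laurent_funs
  by (auto intro: laurent_funs_inverse_qnorm)

setup_lifting type_definition_laurent

instantiation laurent :: comm_ring_1
begin

lift_definition zero_laurent :: laurent is "\<lambda>Z. 0"
  using laurent_funs_cut[OF poly_funs.const[of 0]] by (simp cong: if_cong)
lift_definition one_laurent :: laurent is "\<lambda>Z. if qnorm Z = 0 then 0 else 1"
  by (intro laurent_funs_cut poly_funs.const)
lift_definition plus_laurent :: "laurent \<Rightarrow> laurent \<Rightarrow> laurent" is "\<lambda>f g Z. f Z + g Z"
  by (rule laurent_funs_closed)
lift_definition times_laurent :: "laurent \<Rightarrow> laurent \<Rightarrow> laurent" is "\<lambda>f g Z. f Z * g Z"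
  by (rule laurent_funs_closed)
lift_definition uminus_laurent :: "laurent \<Rightarrow> laurent" is "\<lambda>f Z. - f Z"
  by (rule laurent_funs_uminus)
lift_definition minus_laurent :: "laurent \<Rightarrow> laurent \<Rightarrow> laurent" is "\<lambda>f g Z. f Z - g Z"
  using laurent_funs_closed(1)[OF _ laurent_funs_uminus] by auto

instance
proof
  show "(0::laurent) \<noteq> 1"
    by transfer (auto simp: fun_eq_iff intro!: exI[of _ "mat 1"])
qed (transfer; auto simp: fun_eq_iff algebra_simps laurent_funs_vanish)+

end

lift_definition const :: "complex \<Rightarrow> laurent" is "\<lambda>c Z. if qnorm Z = 0 then 0 else c"
  by (intro laurent_funs_cut poly_funs.const)
lift_definition entry :: "2 \<Rightarrow> 2 \<Rightarrow> laurent" is "\<lambda>a b Z. if qnorm Z = 0 then 0 else Z $ a $ b"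
  by (intro laurent_funs_cut poly_funs_entry)
lift_definition invN :: laurent is "\<lambda>Z. if qnorm Z = 0 then 0 else 1 / qnorm Z"
  by (rule laurent_funs_inverse_qnorm)
lift_definition pdiff :: "2 \<Rightarrow> 2 \<Rightarrow> laurent \<Rightarrow> laurent" is partial
  by (rule laurent_funs_partial)
lift_definition ev :: "laurent \<Rightarrow> hc \<Rightarrow> complex" is "\<lambda>f. f" .

definition N :: laurent where "N = entry 1 1 * entry 2 2 - entry 1 2 * entry 2 1"

lemma ev_simps [simp]:
  "ev 0 Z = 0" "ev (f + g) Z = ev f Z + ev g Z" "ev (f * g) Z = ev f Z * ev g Z"
  "ev (f - g) Z = ev f Z - ev g Z" "ev (- f) Z = - ev f Z"
  by (transfer; simp)+

lemma ev_add_fun: "ev (f + g) = (\<lambda>Z. ev f Z + ev g Z)" and ev_mult_fun: "ev (f * g) = (\<lambda>Z. ev f Z * ev g Z)"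
  by auto

lemma ev_sing: "qnorm Z = 0 \<Longrightarrow> ev f Z = 0"
  by transfer (rule laurent_funs_vanish)

lemma ev_atoms:
  assumes "qnorm Z \<noteq> 0"
  shows "ev 1 Z = 1" "ev (const c) Z = c" "ev (entry a b) Z = Z $ a $ b" "ev invN Z = 1 / qnorm Z"
    "ev N Z = qnorm Z"
proof -
  show e: "ev 1 Z = 1" "ev (const c) Z = c" "ev invN Z = 1 / qnorm Z"
    and i: "ev (entry a b) Z = Z $ a $ b" for a b
    by (use assms in \<open>transfer; simp\<close>)+
  show "ev N Z = qnorm Z" by (simp add: N_def i det_2)
qed

text \<open>Two elements of the ring may be compared in the field of complex numbers, where more
  automation is available than in a ring that is not known to be a domain.\<close>

lemma laurent_eqI: "(\<And>Z. qnorm Z \<noteq> 0 \<Longrightarrow> ev f Z = ev g Z) \<Longrightarrow> f = g"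
  by transfer (metis ext laurent_funs_vanish)

lemma const_hom [simp]:
  "const 0 = 0" "const 1 = 1"
  by (rule laurent_eqI; simp add: ev_atoms)+

lemma const_arith:
  "const (a + b) = const a + const b" "const (a * b) = const a * const b"
  "const (a - b) = const a - const b" "const (- a) = - const a"
  by (rule laurent_eqI; simp add: ev_atoms)+

lemma const_of_nat: "const (of_nat n) = of_nat n"
  by (induction n) (simp_all add: const_arith)

lemma const_numeral [simp]: "const (numeral n) = numeral n"
  using const_of_nat[of "numeral n"] by simp

lemma const_of_int: "const (of_int n) = of_int n"
  by (cases n) (simp_all add: const_of_nat const_arith)

lemma N_invN [simp]: "N * invN = 1"
  by (rule laurent_eqI) (simp add: ev_atoms)

lemma has_gradient_ev:
  "qnorm Z \<noteq> 0 \<Longrightarrow> has_gradient (ev f) (\<lambda>a b. ev (pdiff a b f) Z) Z"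
  by transfer (rule has_gradient_partial)

lemma pdiff_eqI:
  assumes "\<And>Z. qnorm Z \<noteq> 0 \<Longrightarrow> has_gradient (ev f) (\<lambda>a b. ev (q a b) Z) Z"
  shows "pdiff a b f = q a b"
proof (rule laurent_eqI)
  fix Z :: hc assume Z: "qnorm Z \<noteq> 0"
  have "ev (pdiff a b f) Z = partial a b (ev f) Z" by transfer (rule refl)
  also have "\<dots> = ev (q a b) Z" by (rule partial_eq[OF assms[OF Z] Z])
  finally show "ev (pdiff a b f) Z = ev (q a b) Z" .
qed

lemma pdiff_add [simp]: "pdiff a b (f + g) = pdiff a b f + pdiff a b g"
proof (rule pdiff_eqI)
  fix Z :: hc assume Z: "qnorm Z \<noteq> 0"
  show "has_gradient (ev (f + g)) (\<lambda>a b. ev (pdiff a b f + pdiff a b g) Z) Z"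
    unfolding ev_add_fun
    by (rule has_derivative_eq_rhs[OF has_derivative_add[OF has_gradient_ev[OF Z] has_gradient_ev[OF Z]]])
      (simp add: sum.distrib distrib_left)
qed

lemma pdiff_mult [simp]: "pdiff a b (f * g) = pdiff a b f * g + f * pdiff a b g"
proof (rule pdiff_eqI)
  fix Z :: hc assume Z: "qnorm Z \<noteq> 0"
  show "has_gradient (ev (f * g)) (\<lambda>a b. ev (pdiff a b f * g + f * pdiff a b g) Z) Z"
    unfolding ev_mult_fun
    by (rule has_derivative_eq_rhs[OF has_derivative_mult[OF has_gradient_ev[OF Z] has_gradient_ev[OF Z]]])
      (simp add: sum_2 algebra_simps)
qed

lemma pdiff_const [simp]: "pdiff a b (const c) = 0"
proof (rule pdiff_eqI)
  fix Z :: hc assume Z: "qnorm Z \<noteq> 0"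
  have "has_gradient (\<lambda>_. c) (\<lambda>a b. ev 0 Z) Z" by simp
  then show "has_gradient (ev (const c)) (\<lambda>a b. ev 0 Z) Z"
    by (rule has_derivative_transform_within_open[OF _ open_invertibles]) (auto simp: ev_atoms Z)
qed

lemma pdiff_entry: "pdiff a b (entry c d) = (if a = c \<and> b = d then 1 else 0)"
proof (rule pdiff_eqI)
  fix Z :: hc assume Z: "qnorm Z \<noteq> 0"
  have "(\<Sum>a\<in>UNIV. \<Sum>b\<in>UNIV. V $ a $ b * ev (if a = c \<and> b = d then 1 else 0) Z) = V $ c $ d" for V :: hc
    using exhaust_2[of c] exhaust_2[of d] by (auto simp: sum_2 ev_atoms Z)
  then have "has_gradient (\<lambda>Z. Z $ c $ d) (\<lambda>a b. ev (if a = c \<and> b = d then 1 else 0) Z) Z"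
    by (simp only: has_derivative_entry)
  then show "has_gradient (ev (entry c d)) (\<lambda>a b. ev (if a = c \<and> b = d then 1 else 0) Z) Z"
    by (rule has_derivative_transform_within_open[OF _ open_invertibles]) (auto simp: ev_atoms Z)
qed

lemma pdiff_0 [simp]: "pdiff a b 0 = 0" and pdiff_1 [simp]: "pdiff a b 1 = 0"
  using pdiff_const[of a b 0] pdiff_const[of a b 1] by simp_all

lemma pdiff_numeral [simp]: "pdiff a b (numeral n) = 0"
  using pdiff_const[of a b "numeral n"] by simp

lemma pdiff_of_int [simp]: "pdiff a b (of_int n) = 0"
  using pdiff_const[of a b "of_int n"] by (simp add: const_of_int)

lemma pdiff_uminus [simp]: "pdiff a b (- f) = - pdiff a b f"
  using pdiff_add[of a b f "- f"] by (simp add: eq_neg_iff_add_eq_0 add.commute)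

lemma pdiff_diff [simp]: "pdiff a b (f - g) = pdiff a b f - pdiff a b g"
  using pdiff_add[of a b f "- g"] by simp

lemma pdiff_sum [simp]: "pdiff a b (\<Sum>i\<in>A. f i) = (\<Sum>i\<in>A. pdiff a b (f i))"
  by (induction A rule: infinite_finite_induct) auto

lemma pdiff_invN: "pdiff a b invN = - (invN * invN * pdiff a b N)"
proof -
  have "pdiff a b (N * invN) = 0" by simp
  then have "invN * (pdiff a b N * invN + N * pdiff a b invN) = 0" by (simp del: N_invN)
  then have "invN * invN * pdiff a b N + (N * invN) * pdiff a b invN = 0" by (simp only: algebra_simps)
  then show ?thesis by (simp add: eq_neg_iff_add_eq_0 add.commute)
qed

lemma laurent_induct:
  assumes "\<And>c. P (const c)" "\<And>a b. P (entry a b)" "P invN"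
    "\<And>f g. P f \<Longrightarrow> P g \<Longrightarrow> P (f + g)" "\<And>f g. P f \<Longrightarrow> P g \<Longrightarrow> P (f * g)"
  shows "P f"
proof -
  have 1: "\<exists>g. P g \<and> (\<forall>Z. qnorm Z \<noteq> 0 \<longrightarrow> ev g Z = p Z)" if "p \<in> poly_funs" for p
    using that
  proof induction
    case (const c)
    show ?case by (rule exI[of _ "const c"]) (auto simp: assms ev_atoms)
  next
    case (add p q)
    then obtain f g where "P f \<and> (\<forall>Z. qnorm Z \<noteq> 0 \<longrightarrow> ev f Z = p Z)" "P g \<and> (\<forall>Z. qnorm Z \<noteq> 0 \<longrightarrow> ev g Z = q Z)" by auto
    then show ?case by (intro exI[of _ "f + g"]) (auto simp: assms)
  next
    case (mult p q)
    then obtain f g where "P f \<and> (\<forall>Z. qnorm Z \<noteq> 0 \<longrightarrow> ev f Z = p Z)" "P g \<and> (\<forall>Z. qnorm Z \<noteq> 0 \<longrightarrow> ev g Z = q Z)" by auto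
    then show ?case by (intro exI[of _ "f * g"]) (auto simp: assms)
  next
    case (coord j)
    define g where "g = (if j = 0 then const (1/2) * (entry 1 1 + entry 2 2)
      else if j = 1 then const (\<i>/2) * (entry 1 2 + entry 2 1)
      else if j = 2 then const (1/2) * (entry 2 1 + const (-1) * entry 1 2)
      else const (\<i>/2) * (entry 1 1 + const (-1) * entry 2 2))"
    have "P g" unfolding g_def by (auto intro!: assms)
    moreover have "ev g Z = coord j Z" if "qnorm Z \<noteq> 0" for Z
    proof -
      have "j = 0 \<or> j = 1 \<or> j = 2 \<or> j = 3" using coord by auto
      then show ?thesis using that by (elim disjE) (simp_all add: g_def coord_def ev_atoms algebra_simps)
    qed
    ultimately show ?case by blast
  qed
  have "ev f \<in> laurent_funs" by transfer
  then obtain p k where p: "p \<in> poly_funs" and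
    f: "\<And>Z. ev f Z = (if qnorm Z = 0 then 0 else p Z / qnorm Z ^ k)"
    unfolding laurent_funs_def by blast
  obtain g where g: "P g" "\<And>Z. qnorm Z \<noteq> 0 \<Longrightarrow> ev g Z = p Z" using 1[OF p] by blast
  have 2: "P (invN ^ k) \<and> (\<forall>Z. qnorm Z \<noteq> 0 \<longrightarrow> ev (invN ^ k) Z = 1 / qnorm Z ^ k)" for k
  proof (induction k)
    case 0
    then show ?case using assms(1)[of 1] by (simp add: ev_atoms)
  next
    case (Suc k)
    then show ?case by (simp add: assms(3,5) ev_atoms)
  qed
  have "f = g * invN ^ k"
    by (rule laurent_eqI) (simp add: f g 2)
  then show ?thesis using assms(5)[OF g(1)] 2 by simp
qed

text \<open>It suffices to check the generators: both sides obey the same product rule.\<close>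

lemma pdiff_comm: "pdiff a b (pdiff c d f) = pdiff c d (pdiff a b f)"
proof (induction f rule: laurent_induct)
  case (2 i j)
  then show ?case by (simp add: pdiff_entry)
next
  case 3
  have "pdiff a b (pdiff c d N) = pdiff c d (pdiff a b N)" by (simp add: N_def pdiff_entry)
  then show ?case by (simp add: pdiff_invN algebra_simps)
next
  case (5 f g)
  show ?case by (simp add: 5 add_ac)
qed simp_all

lemma pdiff_order [simp]:
  "pdiff 1 2 (pdiff 1 1 f) = pdiff 1 1 (pdiff 1 2 f)" "pdiff 2 1 (pdiff 1 1 f) = pdiff 1 1 (pdiff 2 1 f)"
  "pdiff 2 2 (pdiff 1 1 f) = pdiff 1 1 (pdiff 2 2 f)" "pdiff 2 1 (pdiff 1 2 f) = pdiff 1 2 (pdiff 2 1 f)"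
  "pdiff 2 2 (pdiff 1 2 f) = pdiff 1 2 (pdiff 2 2 f)" "pdiff 2 2 (pdiff 2 1 f) = pdiff 2 1 (pdiff 2 2 f)"
  by (rule pdiff_comm)+

section \<open>Solutions of the differential equation and the operators acting on them\<close>

text \<open>Both columns and rows are pairs of ring elements.

  In the entries of \<open>Z\<close> the operator \<open>\<nabla>\<close> is twice the matrix whose \<open>(i, j)\<close> entry is the
  derivative along the entry \<open>(j, i)\<close>, and \<open>\<box>\<close> is four times the determinant of the
  derivatives. The following two definitions drop these factors.\<close>

type_synonym col = "2 \<Rightarrow> laurent"

definition lap :: "laurent \<Rightarrow> laurent" where
  "lap f = pdiff 1 1 (pdiff 2 2 f) - pdiff 1 2 (pdiff 2 1 f)"

definition dirac :: "col \<Rightarrow> col" where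
  "dirac f i = (\<Sum>j\<in>UNIV. pdiff j i (f j))"

definition euler :: "laurent \<Rightarrow> laurent" where
  "euler f = (\<Sum>a\<in>UNIV. \<Sum>b\<in>UNIV. entry a b * pdiff a b f)"

definition quasi :: "col \<Rightarrow> bool" where
  "quasi f \<longleftrightarrow> (\<forall>i. dirac (\<lambda>j. lap (f j)) i = 0)"

text \<open>Euler's equation replaces homogeneity, with which it agrees on Laurent functions
  (\<open>euler_iff_homogeneous\<close>).\<close>

definition graded :: "int \<Rightarrow> col \<Rightarrow> bool" where
  "graded n f \<longleftrightarrow> quasi f \<and> (\<forall>i. euler (f i) = of_int n * f i)"

text \<open>The next three operators give the action of the matrix units of the Lie algebra: in the lower
  left block, in the upper left block, and in the lower right block. A matrix unit in the upper right
  block acts as the negative of a derivation.\<close>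

definition conformal_op :: "2 \<Rightarrow> 2 \<Rightarrow> col \<Rightarrow> col" where
  "conformal_op c d f i = (\<Sum>a\<in>UNIV. \<Sum>b\<in>UNIV. entry a c * entry d b * pdiff a b (f i)) - entry i c * f d + entry d c * f i"

definition left_op :: "2 \<Rightarrow> 2 \<Rightarrow> col \<Rightarrow> col" where
  "left_op c d f i = (if i = c then f d else 0) - (if c = d then f i else 0) - (\<Sum>b\<in>UNIV. entry d b * pdiff c b (f i))"

definition right_op :: "2 \<Rightarrow> 2 \<Rightarrow> col \<Rightarrow> col" where
  "right_op c d f i = (\<Sum>a\<in>UNIV. entry a c * pdiff a d (f i))"

lemmas cases_2 = disjE[OF exhaust_2]

lemmas operator_defs = lap_def dirac_def euler_def conformal_op_def left_op_def right_op_def N_def sum_2 pdiff_entry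

lemma linear_ops:
  "lap (f + g) = lap f + lap g" "lap (const c * f) = const c * lap f"
  "euler (f + g) = euler f + euler g" "euler (const c * f) = const c * euler f"
  "lap (- f) = - lap f" "euler (- f) = - euler f"
  "lap (f - g) = lap f - lap g" "euler (f - g) = euler f - euler g"
  "lap 0 = 0" "euler 0 = 0"
  by (simp_all add: operator_defs algebra_simps)

lemma lap_pdiff: "lap (pdiff a b f) = pdiff a b (lap f)"
  by (simp add: lap_def pdiff_comm[of a b])

lemma euler_pdiff: "euler (pdiff a b f) = pdiff a b (euler f) - pdiff a b f"
  by (rule cases_2[of a]; rule cases_2[of b]; simp add: operator_defs algebra_simps)

lemma euler_mult: "euler (f * g) = euler f * g + f * euler g"
  by (simp add: operator_defs algebra_simps)

lemma euler_entry: "euler (entry a b) = entry a b"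
  by (rule cases_2[of a]; rule cases_2[of b]; simp add: operator_defs algebra_simps)

lemma euler_N: "euler N = 2 * N"
  by (simp add: operator_defs algebra_simps)

lemma lap_N: "lap (N * f) = N * lap f + 2 * f + euler f"
  by (simp add: operator_defs algebra_simps)

lemma euler_N_power: "euler (N ^ k * f) = N ^ k * (of_nat (2 * k) * f + euler f)"
  by (induction k) (simp_all add: euler_mult euler_N mult.assoc, simp add: algebra_simps)

text \<open>For harmonic \<open>f\<close> of degree \<open>n\<close> this reads
  \<open>\<box>(N^(k+1) f) = 4 (k + 1) (k + 2 + n) N^k f\<close>: multiplication by \<open>N\<close> can be undone by \<open>\<box>\<close>
  as long as \<open>k + 2 + n \<noteq> 0\<close>.\<close>

lemma lap_N_power:
  "lap (N ^ Suc k * f) = N ^ Suc k * lap f + N ^ k * (of_nat (Suc k) * (of_nat (k + 2) * f + euler f))"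
proof (induction k)
  case 0
  show ?case by (simp add: lap_N algebra_simps)
next
  case (Suc k)
  have "lap (N ^ Suc (Suc k) * f) = N * lap (N ^ Suc k * f) + 2 * (N ^ Suc k * f) + euler (N ^ Suc k * f)"
    using lap_N[of "N ^ Suc k * f"] by (simp add: mult.assoc)
  then show ?case unfolding Suc euler_N_power by (simp add: algebra_simps)
qed

abbreviation nabla_box :: "col \<Rightarrow> col" where "nabla_box f \<equiv> dirac (\<lambda>j. lap (f j))"

text \<open>Covariance of \<open>\<nabla>\<box>\<close>: on the right, only \<open>\<nabla>\<box>f\<close> and its derivatives occur, so
  the operator maps solutions to solutions.\<close>

lemma nabla_box_conformal: "nabla_box (conformal_op c d f) i = (\<Sum>a\<in>UNIV. \<Sum>b\<in>UNIV. entry a c * entry d b * pdiff a b (nabla_box f i))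
    + 3 * entry d c * nabla_box f i + (if i = c then \<Sum>j\<in>UNIV. entry d j * nabla_box f j else 0)"
  by (rule cases_2[of c]; rule cases_2[of d]; rule cases_2[of i]; simp add: operator_defs algebra_simps)

lemma nabla_box_left: "nabla_box (left_op c d f) i = - (\<Sum>b\<in>UNIV. entry d b * pdiff c b (nabla_box f i)) - (if c = d then 2 * nabla_box f i else 0)"
  by (rule cases_2[of c]; rule cases_2[of d]; rule cases_2[of i]; simp add: operator_defs algebra_simps)

lemma nabla_box_right: "nabla_box (right_op c d f) i = (\<Sum>a\<in>UNIV. entry a c * pdiff a d (nabla_box f i))
   + (if i = c then nabla_box f d else 0) + (if c = d then nabla_box f i else 0)"
  by (rule cases_2[of c]; rule cases_2[of d]; rule cases_2[of i]; simp add: operator_defs algebra_simps)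

lemma nabla_box_pdiff: "nabla_box (\<lambda>j. pdiff c d (f j)) i = pdiff c d (nabla_box f i)"
  by (simp add: dirac_def lap_pdiff pdiff_comm[of c d])

lemma euler_conformal: "euler (conformal_op c d f i) = conformal_op c d (\<lambda>j. euler (f j)) i + conformal_op c d f i"
  by (rule cases_2[of c]; rule cases_2[of d]; rule cases_2[of i]; simp add: operator_defs algebra_simps)

lemma euler_left: "euler (left_op c d f i) = left_op c d (\<lambda>j. euler (f j)) i"
  by (rule cases_2[of c]; rule cases_2[of d]; rule cases_2[of i]; simp add: operator_defs algebra_simps)

lemma euler_right: "euler (right_op c d f i) = right_op c d (\<lambda>j. euler (f j)) i"
  by (rule cases_2[of c]; rule cases_2[of d]; rule cases_2[of i]; simp add: operator_defs algebra_simps)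

lemma scale_ops:
  "conformal_op c d (\<lambda>j. of_int n * f j) i = of_int n * conformal_op c d f i"
  "left_op c d (\<lambda>j. of_int n * f j) i = of_int n * left_op c d f i"
  "right_op c d (\<lambda>j. of_int n * f j) i = of_int n * right_op c d f i"
  by (auto simp: conformal_op_def left_op_def right_op_def algebra_simps sum_distrib_left)

lemma graded_conformal: "graded n f \<Longrightarrow> graded (n + 1) (conformal_op c d f)"
  unfolding graded_def quasi_def by (auto simp: nabla_box_conformal euler_conformal scale_ops algebra_simps)

lemma graded_left: "graded n f \<Longrightarrow> graded n (left_op c d f)"
  unfolding graded_def quasi_def by (auto simp: nabla_box_left euler_left scale_ops)

lemma graded_right: "graded n f \<Longrightarrow> graded n (right_op c d f)"
  unfolding graded_def quasi_def by (auto simp: nabla_box_right euler_right scale_ops)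

lemma graded_pdiff: "graded n f \<Longrightarrow> graded (n - 1) (\<lambda>i. pdiff c d (f i))"
  unfolding graded_def quasi_def by (auto simp: nabla_box_pdiff euler_pdiff algebra_simps)

lemma graded_add: "graded n f \<Longrightarrow> graded n g \<Longrightarrow> graded n (f + g)"
  unfolding graded_def quasi_def by (auto simp: dirac_def linear_ops algebra_simps sum.distrib)

lemma graded_scale: "graded n f \<Longrightarrow> graded n (\<lambda>i. const c * f i)"
  unfolding graded_def quasi_def by (auto simp: dirac_def linear_ops algebra_simps sum_distrib_left[symmetric])

lemma graded_zero: "graded n 0"
  unfolding graded_def quasi_def by (auto simp: dirac_def linear_ops)

section \<open>Lowering and raising combined\<close>

text \<open>The sum over dual bases of lowering followed by raising. It commutes with the two diagonal
  blocks. Under these the solutions of one degree have at most three irreducible components, so by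
  Schur's lemma at most three eigenvalues are to be expected.\<close>

definition lower_raise :: "col \<Rightarrow> col" where
  "lower_raise f i = (\<Sum>c\<in>UNIV. \<Sum>d\<in>UNIV. conformal_op c d (\<lambda>j. pdiff d c (f j)) i)"

definition raise_lower :: "col \<Rightarrow> col" where
  "raise_lower f i = (\<Sum>c\<in>UNIV. \<Sum>d\<in>UNIV. pdiff d c (conformal_op c d f i))"

definition Zdirac :: "col \<Rightarrow> col" where
  "Zdirac f i = (\<Sum>j\<in>UNIV. entry i j * dirac f j)"

definition Nlap :: "col \<Rightarrow> col" where
  "Nlap f i = N * lap (f i)"

text \<open>The second-order part is evaluated as in Capelli's identity: with \<open>E\<close> the Euler operator, the sum
  of all \<open>Z\<^sub>a\<^sub>c Z\<^sub>d\<^sub>b \<partial>\<^sub>a\<^sub>b \<partial>\<^sub>d\<^sub>c\<close> is \<open>E (E - 1) - N\<box> / 2\<close>.\<close>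

lemma lower_raise_eq: "lower_raise f i = euler (euler (f i)) - 2 * Nlap f i - Zdirac f i"
  by (rule cases_2[of i]; simp add: lower_raise_def Nlap_def Zdirac_def operator_defs algebra_simps)

lemma raise_lower_eq: "raise_lower f i = lower_raise f i + 4 * euler (f i) + 2 * f i"
  by (rule cases_2[of i]; simp add: lower_raise_def raise_lower_def operator_defs algebra_simps)

lemma lap_Zdirac: "lap (Zdirac f i) = lap (f i) + (\<Sum>j\<in>UNIV. entry i j * nabla_box f j)"
  by (rule cases_2[of i]; simp add: Zdirac_def operator_defs algebra_simps)

lemma Zdirac_Zdirac: "Zdirac (Zdirac f) i = 2 * Zdirac f i + (\<Sum>j\<in>UNIV. entry i j * euler (dirac f j)) - Nlap f i"
  by (rule cases_2[of i]; simp add: Zdirac_def Nlap_def operator_defs algebra_simps)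

lemma lap_Nlap: "lap (Nlap f i) = N * lap (lap (f i)) + 2 * lap (f i) + euler (lap (f i))"
  by (simp add: Nlap_def lap_N)

lemma Zdirac_Nlap: "Zdirac (Nlap f) i = N * (\<Sum>j\<in>UNIV. entry i j * nabla_box f j) + Nlap f i"
  by (rule cases_2[of i]; simp add: Zdirac_def Nlap_def operator_defs algebra_simps)

lemma lap_via_dirac: "lap (g 1) = pdiff 2 2 (dirac g 1) - pdiff 2 1 (dirac g 2)"
  "lap (g 2) = pdiff 1 1 (dirac g 2) - pdiff 1 2 (dirac g 1)"
  by (simp_all add: operator_defs algebra_simps)

lemma dirac_zero_imp_lap_zero: "(\<And>i. dirac g i = 0) \<Longrightarrow> lap (g i) = 0"
  by (rule cases_2[of i]; simp add: lap_via_dirac)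

lemma euler_dirac: "euler (dirac f i) = dirac (\<lambda>j. euler (f j)) i - dirac f i"
  by (simp add: dirac_def linear_ops euler_pdiff sum_2)

lemma euler_lap: "euler (lap f) = lap (euler f) - 2 * lap f"
  by (simp add: lap_def linear_ops euler_pdiff)

lemma of_int_ops: "dirac (\<lambda>j. of_int n * f j) i = of_int n * dirac f i" "lap (of_int n * g) = of_int n * lap g"
  "euler (of_int n * g) = of_int n * euler g"
  by (simp_all add: operator_defs algebra_simps)

lemma graded_dirac_lap:
  assumes "graded n f"
  shows "euler (dirac f i) = (of_int n - 1) * dirac f i" "euler (lap (f i)) = (of_int n - 2) * lap (f i)"
    "euler (Nlap f i) = of_int n * Nlap f i" "euler (Zdirac f i) = of_int n * Zdirac f i"
    "lap (lap (f i)) = 0" "lap (dirac f i) = 0" "nabla_box f i = 0"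
proof -
  show a: "euler (dirac f i) = (of_int n - 1) * dirac f i" "euler (lap (f i)) = (of_int n - 2) * lap (f i)" for i
    using assms by (simp_all add: graded_def euler_dirac euler_lap of_int_ops algebra_simps)
  show "euler (Nlap f i) = of_int n * Nlap f i" "euler (Zdirac f i) = of_int n * Zdirac f i"
    by (simp_all add: Nlap_def Zdirac_def euler_mult euler_N euler_entry a sum_2 linear_ops algebra_simps)
  show q: "nabla_box f i = 0" for i using assms by (simp add: graded_def quasi_def)
  show "lap (lap (f i)) = 0" by (rule dirac_zero_imp_lap_zero) (rule q)
  show "lap (dirac f i) = 0" using q[of i] by (simp add: dirac_def lap_pdiff linear_ops sum_2)
qed

lemma graded_Nlap_Zdirac:
  assumes "graded n f"
  shows "graded n (Nlap f)" "graded n (Zdirac f)"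
proof -
  note g = graded_dirac_lap[OF assms]
  have "lap (Nlap f i) = of_int n * lap (f i)" for i by (simp add: lap_Nlap g algebra_simps)
  then show "graded n (Nlap f)" by (simp add: graded_def quasi_def g of_int_ops)
  have "lap (Zdirac f i) = lap (f i)" for i by (simp add: lap_Zdirac g)
  then show "graded n (Zdirac f)" by (simp add: graded_def quasi_def g)
qed

text \<open>The operator is triangular on \<open>f\<close>, \<open>N\<box>f\<close>, \<open>Z\<nabla>f\<close>: since \<open>\<nabla>\<box>f = 0\<close>, applying
  \<open>\<box>\<close> and \<open>\<nabla>\<close> to the last two does not lead to anything new.\<close>

lemma lower_raise_graded:
  assumes "graded n f"
  shows "lower_raise f i = of_int (n\<^sup>2) * f i - 2 * Nlap f i - Zdirac f i"
    "lower_raise (Nlap f) i = of_int (n\<^sup>2 - 2 * n - 1) * Nlap f i"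
    "lower_raise (Zdirac f) i = of_int (n\<^sup>2 - n - 1) * Zdirac f i - Nlap f i"
proof -
  note g = graded_dirac_lap[OF assms]
  have "euler (f i) = of_int n * f i" using assms by (simp add: graded_def)
  then show "lower_raise f i = of_int (n\<^sup>2) * f i - 2 * Nlap f i - Zdirac f i"
    by (simp add: lower_raise_eq of_int_ops power2_eq_square)
  have 1: "Nlap (Nlap f) i = of_int n * Nlap f i"
    unfolding Nlap_def[of "Nlap f"] by (simp add: lap_Nlap g) (simp add: Nlap_def algebra_simps)
  show "lower_raise (Nlap f) i = of_int (n\<^sup>2 - 2 * n - 1) * Nlap f i"
    by (simp add: lower_raise_eq 1 Zdirac_Nlap g of_int_ops power2_eq_square algebra_simps)
  have 2: "Nlap (Zdirac f) i = Nlap f i" by (simp add: Nlap_def lap_Zdirac g)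
  have 3: "Zdirac (Zdirac f) i = of_int (n + 1) * Zdirac f i - Nlap f i"
    by (simp add: Zdirac_Zdirac g Zdirac_def[of f] sum_2 algebra_simps)
  show "lower_raise (Zdirac f) i = of_int (n\<^sup>2 - n - 1) * Zdirac f i - Nlap f i"
    by (simp add: lower_raise_eq 2 3 g of_int_ops power2_eq_square algebra_simps)
qed

lemma raise_lower_graded:
  assumes "graded n f"
  shows "raise_lower f i = of_int (n\<^sup>2 + 4 * n + 2) * f i - 2 * Nlap f i - Zdirac f i"
    "raise_lower (Nlap f) i = of_int ((n + 1)\<^sup>2) * Nlap f i"
    "raise_lower (Zdirac f) i = of_int (n\<^sup>2 + 3 * n + 1) * Zdirac f i - Nlap f i"
proof -
  note g = graded_dirac_lap[OF assms]
  have "euler (f i) = of_int n * f i" using assms by (simp add: graded_def)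
  then show "raise_lower f i = of_int (n\<^sup>2 + 4 * n + 2) * f i - 2 * Nlap f i - Zdirac f i"
    by (simp add: raise_lower_eq lower_raise_graded[OF assms] algebra_simps)
  show "raise_lower (Nlap f) i = of_int ((n + 1)\<^sup>2) * Nlap f i"
    by (simp add: raise_lower_eq lower_raise_graded[OF assms] g power2_eq_square algebra_simps)
  show "raise_lower (Zdirac f) i = of_int (n\<^sup>2 + 3 * n + 1) * Zdirac f i - Nlap f i"
    by (simp add: raise_lower_eq lower_raise_graded[OF assms] g algebra_simps)
qed

definition cscale :: "complex \<Rightarrow> col \<Rightarrow> col" where
  "cscale c f = (\<lambda>i. const c * f i)"

interpretation col: vector_space cscale
  by unfold_locales (auto simp: cscale_def fun_eq_iff algebra_simps const_arith)

lemma of_int_cancel: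
  assumes "m \<noteq> 0" "of_int m * (f :: laurent) = of_int m * g"
  shows "f = g"
proof -
  have "const (1 / of_int m) * (of_int m * f) = const (1 / of_int m) * (of_int m * g)" by (simp add: assms)
  moreover have "const (1 / of_int m) * of_int m = 1"
    using assms(1) by (simp flip: const_of_int const_arith)
  ultimately show ?thesis by (simp add: mult.assoc[symmetric])
qed

lemma subspace_int_mult:
  assumes "col.subspace W" "f \<in> W" shows "(\<lambda>i. of_int m * f i) \<in> W"
  using col.subspace_scale[OF assms, of "of_int m"] by (simp add: cscale_def const_of_int)

lemma subspace_int_cancel:
  assumes "col.subspace W" "m \<noteq> 0" "(\<lambda>i. of_int m * f i) \<in> W" shows "f \<in> W"
proof -
  have "cscale (1 / of_int m) (\<lambda>i. of_int m * f i) = f"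
    using assms(2) by (simp add: cscale_def fun_eq_iff mult.assoc[symmetric] flip: const_of_int const_arith)
  then show ?thesis using col.subspace_scale[OF assms(1,3)] by metis
qed

text \<open>The diagonal entries of the triangular systems that are not squares: all four quadratics have
  irrational roots.\<close>

lemma nonzero_quadratics:
  "(n::int)\<^sup>2 - 2 * n - 1 \<noteq> 0" "n\<^sup>2 - n - 1 \<noteq> 0" "n\<^sup>2 + 4 * n + 2 \<noteq> 0" "n\<^sup>2 + 3 * n + 1 \<noteq> 0"
proof -
  have unit: "n = 1 \<or> n = -1" if "n * m = 1" for m using that by (simp add: zmult_eq_1_iff) blast
  show "n\<^sup>2 - 2 * n - 1 \<noteq> 0"
    using unit[of "n - 2"] by (auto simp: power2_eq_square algebra_simps)
  show "n\<^sup>2 - n - 1 \<noteq> 0"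
    using unit[of "n - 1"] by (auto simp: power2_eq_square algebra_simps)
  show "n\<^sup>2 + 3 * n + 1 \<noteq> 0"
    using unit[of "- n - 3"] by (auto simp: power2_eq_square algebra_simps)
  show "n\<^sup>2 + 4 * n + 2 \<noteq> 0"
  proof
    assume 0: "n\<^sup>2 + 4 * n + 2 = 0"
    then have "2 = n * (- n - 4)" by (simp add: power2_eq_square algebra_simps)
    then have "n dvd 2" by (rule dvdI)
    then have "\<bar>n\<bar> \<le> 2" using dvd_imp_le_int[of 2 n] by simp
    then have "n = -2 \<or> n = -1 \<or> n = 0 \<or> n = 1 \<or> n = 2" by arith
    with 0 show False by auto
  qed
qed

text \<open>Back substitution in a triangular system with nonzero integer diagonal.\<close>

lemma triangular_subspace:
  fixes T :: "col \<Rightarrow> col"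
  assumes W: "col.subspace W" and T: "T f \<in> W" "T u \<in> W" "T v \<in> W"
    and eq: "\<And>i. T f i = of_int p * f i - 2 * u i - v i" "\<And>i. T u i = of_int q * u i"
       "\<And>i. T v i = of_int r * v i - u i"
    and nz: "p \<noteq> 0" "q \<noteq> 0" "r \<noteq> 0"
  shows "f \<in> W"
proof -
  have "(\<lambda>i. of_int q * u i) \<in> W" using T(2) by (simp flip: eq)
  then have u: "u \<in> W" by (rule subspace_int_cancel[OF W nz(2)])
  have "(\<lambda>i. of_int r * v i) = T v + u" by (auto simp: eq)
  then have "(\<lambda>i. of_int r * v i) \<in> W" using col.subspace_add[OF W T(3) u] by simp
  then have v: "v \<in> W" by (rule subspace_int_cancel[OF W nz(3)])
  have "(\<lambda>i. of_int p * f i) = T f + (u + (u + v))" by (auto simp: eq)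
  moreover have "T f + (u + (u + v)) \<in> W" using T u v by (intro col.subspace_add[OF W])
  ultimately have "(\<lambda>i. of_int p * f i) \<in> W" by simp
  then show "f \<in> W" by (rule subspace_int_cancel[OF W nz(1)])
qed

text \<open>Every homogeneous solution of nonzero degree is recovered from images of
  \<open>lower_raise\<close>, hence from lowered solutions by raising.\<close>

lemma lower_raise_preimage:
  assumes W: "col.subspace W" and f: "graded n f" and n: "n \<noteq> 0" and im: "\<And>g. graded n g \<Longrightarrow> lower_raise g \<in> W"
  shows "f \<in> W"
proof (rule triangular_subspace[OF W _ _ _ lower_raise_graded[OF f]])
  show "lower_raise f \<in> W" "lower_raise (Nlap f) \<in> W" "lower_raise (Zdirac f) \<in> W"
    by (intro im f graded_Nlap_Zdirac[OF f])+
qed (use n nonzero_quadratics[of n] in simp_all)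

text \<open>The mirror image: away from degree \<open>-1\<close>, solutions are recovered from raised solutions by
  lowering.\<close>

lemma raise_lower_preimage:
  assumes W: "col.subspace W" and f: "graded n f" and n: "n \<noteq> -1" and im: "\<And>g. graded n g \<Longrightarrow> raise_lower g \<in> W"
  shows "f \<in> W"
proof (rule triangular_subspace[OF W _ _ _ raise_lower_graded[OF f]])
  show "raise_lower f \<in> W" "raise_lower (Nlap f) \<in> W" "raise_lower (Zdirac f) \<in> W"
    by (intro im f graded_Nlap_Zdirac[OF f])+
qed (use n nonzero_quadratics[of n] in simp_all)

lemma raise_lower_linear: "raise_lower (\<lambda>i. of_int p * f i + of_int q * g i) i = of_int p * raise_lower f i + of_int q * raise_lower g i"
  by (rule cases_2[of i]; simp add: raise_lower_def operator_defs algebra_simps)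

text \<open>Injectivity does not follow from \<open>raise_lower_preimage\<close>, because the raising operators
  need not annihilate \<open>N\<box>f\<close> and \<open>Z\<nabla>f\<close> together with \<open>f\<close>. Applying the operator twice more to
  \<open>raise_lower f = 0\<close> gives enough equations to eliminate them.\<close>

lemma raise_lower_kernel:
  assumes f: "graded n f" and n: "n \<noteq> -1" and ker: "raise_lower f = 0"
  shows "f = 0"
proof -
  define q r where "q = (n + 1)\<^sup>2" and "r = n\<^sup>2 + 3 * n + 1"
  define a b where "a = Nlap f" and "b = Zdirac f"
  have Ta: "raise_lower a i = of_int q * a i" and Tb: "raise_lower b i = of_int r * b i - a i" for i
    unfolding a_def b_def q_def r_def by (rule raise_lower_graded[OF f])+
  have pf: "of_int (n\<^sup>2 + 4 * n + 2) * f i = 2 * a i + b i" for i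
    using raise_lower_graded(1)[OF f, of i] ker unfolding a_def b_def by (simp add: algebra_simps)
  have 0: "raise_lower (\<lambda>i. 0) = 0"
    using raise_lower_linear[of 0 0 0 0] by (auto simp: fun_eq_iff)
  have "raise_lower (\<lambda>i. of_int 2 * a i + of_int 1 * b i) i = 0" for i
    using raise_lower_linear[of "n\<^sup>2 + 4 * n + 2" f 0 f i] ker pf by simp
  then have 1: "of_int (2 * q - 1) * a i + of_int r * b i = 0" for i
    unfolding raise_lower_linear Ta Tb by (simp add: algebra_simps)
  have 2: "of_int (2 * q - 1) * raise_lower a i + of_int r * raise_lower b i = 0" for i
    using raise_lower_linear[of "2 * q - 1" a r b i] 0 1 by simp
  \<comment> \<open>Eliminates \<open>b\<close>: the second equation minus \<open>r\<close> times the first.\<close>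
  have "of_int ((2 * q - 1) * (q - r) - r) * a i =
     (of_int (2 * q - 1) * raise_lower a i + of_int r * raise_lower b i) - of_int r * (of_int (2 * q - 1) * a i + of_int r * b i)" for i
    unfolding Ta Tb by (simp add: algebra_simps)
  then have "of_int ((2 * q - 1) * (q - r) - r) * a i = of_int ((2 * q - 1) * (q - r) - r) * 0" for i
    unfolding 1 2 by simp
  moreover have "(2 * q - 1) * (q - r) - r = - ((n + 1)\<^sup>2 * (2 * n + 1))"
    unfolding q_def r_def by (simp add: power2_eq_square algebra_simps)
  moreover have "\<dots> \<noteq> 0" using n by (simp; presburger)
  ultimately have a: "a i = 0" for i by (metis of_int_cancel)
  then have "of_int r * b i = of_int r * 0" for i using 1[of i] by simp
  then have b: "b i = 0" for i using nonzero_quadratics(4)[of n] unfolding r_def by (metis of_int_cancel)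
  have "of_int (n\<^sup>2 + 4 * n + 2) * f i = of_int (n\<^sup>2 + 4 * n + 2) * 0" for i using pf[of i] a b by simp
  then have "f i = 0" for i using nonzero_quadratics(3)[of n] by (metis of_int_cancel)
  then show ?thesis by auto
qed

section \<open>Homogeneous harmonic Laurent functions\<close>

lemma has_field_derivative_line:
  assumes Z: "qnorm (A + msc t B) \<noteq> 0"
  shows "((\<lambda>t. ev f (A + msc t B)) has_field_derivative
     (\<Sum>a\<in>UNIV. \<Sum>b\<in>UNIV. B $ a $ b * ev (pdiff a b f) (A + msc t B))) (at t)"
proof -
  have "linear (\<lambda>s. msc s B)"
    by (auto intro!: linearI simp: msc_def vec_eq_iff algebra_simps)
  then have "((\<lambda>s. msc s B) has_derivative (\<lambda>s. msc s B)) (at t)"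
    by (simp add: bounded_linear_imp_has_derivative linear_conv_bounded_linear)
  then have "((\<lambda>t. A + msc t B) has_derivative (\<lambda>s. 0 + msc s B)) (at t)"
    by (rule has_derivative_add[OF has_derivative_const])
  then have "((\<lambda>t. ev f (A + msc t B)) has_derivative
      (\<lambda>s. \<Sum>a\<in>UNIV. \<Sum>b\<in>UNIV. (0 + msc s B) $ a $ b * ev (pdiff a b f) (A + msc t B))) (at t)"
    by (rule has_derivative_compose) (rule has_gradient_ev[OF Z])
  moreover have "(\<Sum>a\<in>UNIV. \<Sum>b\<in>UNIV. (0 + msc s B) $ a $ b * ev (pdiff a b f) (A + msc t B))
     = (\<Sum>a\<in>UNIV. \<Sum>b\<in>UNIV. B $ a $ b * ev (pdiff a b f) (A + msc t B)) * s" for s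
    unfolding sum_2 by (simp add: msc_def algebra_simps del: vec_lambda_unique)
  ultimately show ?thesis unfolding has_field_derivative_def by (simp only:)
qed

lemma qnorm_msc: "qnorm (msc c Z) = c\<^sup>2 * qnorm Z"
  by (simp add: det_2 msc_def power2_eq_square algebra_simps)

lemma ev_euler:
  "ev (euler f) Z = (\<Sum>a\<in>UNIV. \<Sum>b\<in>UNIV. Z $ a $ b * ev (pdiff a b f) Z)"
  by (cases "qnorm Z = 0") (simp_all add: euler_def sum_2 ev_atoms ev_sing)

lemma ev_of_int: "qnorm Z \<noteq> 0 \<Longrightarrow> ev (of_int n) Z = of_int n"
  by (simp flip: const_of_int add: ev_atoms)

text \<open>One direction differentiates at \<open>c = 1\<close>. For the other, \<open>c^(-n) f(c Z)\<close> has derivative zero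
  in \<open>c\<close> on the connected set of nonzero complex numbers.\<close>

lemma euler_iff_homogeneous:
  "euler f = of_int n * f \<longleftrightarrow> (\<forall>c Z. c \<noteq> 0 \<longrightarrow> ev f (msc c Z) = c powi n * ev f Z)"
proof
  assume *: "\<forall>c Z. c \<noteq> 0 \<longrightarrow> ev f (msc c Z) = c powi n * ev f Z"
  show "euler f = of_int n * f"
  proof (rule laurent_eqI)
    fix Z assume Z: "qnorm Z \<noteq> 0"
    have Z1: "msc 1 Z = Z" by (simp add: msc_def vec_eq_iff)
    have "((\<lambda>c. ev f (msc c Z)) has_field_derivative ev (euler f) Z) (at 1)"
      using has_field_derivative_line[of 0 1 Z f] Z by (simp add: ev_euler Z1)
    then have "((\<lambda>c. c powi n * ev f Z) has_field_derivative ev (euler f) Z) (at 1)"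
      by (rule has_field_derivative_transform_within_open[where S = "- {0}"]) (use * in auto)
    moreover have "((\<lambda>c. c powi n * ev f Z) has_field_derivative of_int n * ev f Z) (at 1)"
      by (auto intro!: derivative_eq_intros)
    ultimately have "ev (euler f) Z = of_int n * ev f Z" by (rule DERIV_unique)
    then show "ev (euler f) Z = ev (of_int n * f) Z" using Z by (simp add: ev_of_int)
  qed
next
  assume *: "euler f = of_int n * f"
  show "\<forall>c Z. c \<noteq> 0 \<longrightarrow> ev f (msc c Z) = c powi n * ev f Z"
  proof (intro allI impI)
    fix c :: complex and Z :: hc assume c: "c \<noteq> 0"
    show "ev f (msc c Z) = c powi n * ev f Z"
    proof (cases "qnorm Z = 0")
      case True
      then show ?thesis by (simp add: ev_sing qnorm_msc)
    next
      case Z: False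
      define g where "g c = c powi (- n) * ev f (msc c Z)" for c
      have "(g has_field_derivative 0) (at c)" if c: "c \<noteq> 0" for c
      proof -
        have q: "qnorm (msc c Z) \<noteq> 0" using c Z by (simp add: qnorm_msc)
        have "c * (\<Sum>a\<in>UNIV. \<Sum>b\<in>UNIV. Z $ a $ b * ev (pdiff a b f) (msc c Z)) = ev (euler f) (msc c Z)"
          by (simp add: ev_euler msc_def sum_2 algebra_simps)
        also have "\<dots> = of_int n * ev f (msc c Z)" unfolding * using q by (simp add: ev_of_int)
        finally have e: "(\<Sum>a\<in>UNIV. \<Sum>b\<in>UNIV. Z $ a $ b * ev (pdiff a b f) (msc c Z)) = of_int n * ev f (msc c Z) / c"
          using c by (simp add: field_simps)
        have "((\<lambda>c. ev f (msc c Z)) has_field_derivative of_int n * ev f (msc c Z) / c) (at c)"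
          using has_field_derivative_line[of 0 c Z f] q unfolding add_0 e by blast
        then show ?thesis unfolding g_def [abs_def] using c
          by (auto intro!: derivative_eq_intros simp: power_int_diff field_simps)
      qed
      moreover have "connected (- {0::complex})"
        by (intro connected_punctured_universe) simp
      ultimately obtain k where "\<And>c. c \<in> - {0} \<Longrightarrow> g c = k"
        using DERIV_zero_connected_constant[of "- {0}" "{}" g]
        by (metis Compl_iff DERIV_isCont Diff_iff closed_singleton continuous_at_imp_continuous_on finite.emptyI open_Compl singletonI)
      then have "g c = g 1" using c by simp
      moreover have "msc 1 Z = Z" by (simp add: msc_def vec_eq_iff)
      ultimately show ?thesis unfolding g_def using c by (simp add: power_int_minus field_simps)
    qed
  qed
qed

text \<open>Agreement is required on the invertible matrices only, since elements of the ring vanish at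
  the others.\<close>

definition poly_like :: "laurent \<Rightarrow> bool" where
  "poly_like f \<longleftrightarrow> (\<exists>p\<in>poly_funs. \<forall>Z. qnorm Z \<noteq> 0 \<longrightarrow> ev f Z = p Z)"

lemma poly_likeI: "p \<in> poly_funs \<Longrightarrow> (\<And>Z. qnorm Z \<noteq> 0 \<Longrightarrow> ev f Z = p Z) \<Longrightarrow> poly_like f"
  unfolding poly_like_def by (rule bexI) auto

lemma poly_likeE:
  assumes "poly_like f"
  obtains p where "p \<in> poly_funs" "\<And>Z. qnorm Z \<noteq> 0 \<Longrightarrow> ev f Z = p Z"
  using assms unfolding poly_like_def by (elim bexE) simp

lemma poly_like_clear: "\<exists>k. poly_like (N ^ k * f)"
proof -
  have "ev f \<in> laurent_funs" by transfer
  then obtain p k where p: "p \<in> poly_funs" and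
    f: "\<And>Z. ev f Z = (if qnorm Z = 0 then 0 else p Z / qnorm Z ^ k)"
    unfolding laurent_funs_def by blast
  have k: "ev (N ^ j) Z = qnorm Z ^ j" if "qnorm Z \<noteq> 0" for Z j
    by (induction j) (simp_all add: ev_atoms that)
  have "poly_like (N ^ k * f)"
  proof (rule poly_likeI[OF p])
    fix Z :: hc assume Z: "qnorm Z \<noteq> 0"
    show "ev (N ^ k * f) Z = p Z" unfolding ev_simps k[OF Z] f using Z by simp
  qed
  then show ?thesis ..
qed

lemma poly_like_pdiff:
  assumes "poly_like f" shows "poly_like (pdiff a b f)"
proof -
  from assms obtain p where p: "p \<in> poly_funs" and f: "\<And>Z. qnorm Z \<noteq> 0 \<Longrightarrow> ev f Z = p Z"
    by (elim poly_likeE) (rule that)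
  obtain p' where p': "\<forall>a b. p' a b \<in> poly_funs" "\<forall>Z. has_gradient p (\<lambda>a b. p' a b Z) Z"
    using poly_funs_has_gradient[OF p] by (elim exE conjE)
  show ?thesis
  proof (rule poly_likeI)
    show "p' a b \<in> poly_funs" using p'(1) by simp
    fix Z :: hc assume Z: "qnorm Z \<noteq> 0"
    have "has_gradient (ev f) (\<lambda>a b. p' a b Z) Z"
      by (rule has_derivative_transform_within_open[OF p'(2)[rule_format] open_invertibles]) (use Z f in simp_all)
    then have "partial a b (ev f) Z = p' a b Z" by (rule partial_eq[OF _ Z])
    moreover have "ev (pdiff a b f) Z = partial a b (ev f) Z" by transfer (rule refl)
    ultimately show "ev (pdiff a b f) Z = p' a b Z" by simp
  qed
qed

lemma poly_like_add:
  assumes "poly_like f" "poly_like g" shows "poly_like (f + g)"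
proof -
  from assms(1) obtain p where p: "p \<in> poly_funs" "\<And>Z. qnorm Z \<noteq> 0 \<Longrightarrow> ev f Z = p Z"
    by (elim poly_likeE) (rule that)
  from assms(2) obtain q where q: "q \<in> poly_funs" "\<And>Z. qnorm Z \<noteq> 0 \<Longrightarrow> ev g Z = q Z"
    by (elim poly_likeE) (rule that)
  show ?thesis by (rule poly_likeI[OF poly_funs.add[OF p(1) q(1)]]) (simp add: p q)
qed

lemma poly_like_scale:
  assumes "poly_like f" shows "poly_like (const c * f)"
proof -
  from assms obtain p where p: "p \<in> poly_funs" "\<And>Z. qnorm Z \<noteq> 0 \<Longrightarrow> ev f Z = p Z"
    by (elim poly_likeE) (rule that)
  show ?thesis by (rule poly_likeI[OF poly_funs.mult[OF poly_funs.const[of c] p(1)]]) (simp add: p ev_atoms)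
qed

lemma poly_like_lap: "poly_like f \<Longrightarrow> poly_like (lap f)"
proof -
  assume "poly_like f"
  then have "poly_like (pdiff 1 1 (pdiff 2 2 f) + const (-1) * pdiff 1 2 (pdiff 2 1 f))"
    by (intro poly_like_add poly_like_scale poly_like_pdiff)
  then show ?thesis by (simp add: lap_def const_arith)
qed

lemma poly_funs_continuous: "p \<in> poly_funs \<Longrightarrow> isCont p Z"
  by (drule poly_funs_has_gradient) (elim exE conjE, rule has_derivative_continuous, rule spec)

text \<open>Along the ray through \<open>Z\<close> the function \<open>t^(-n) p(t Z)\<close> is constant, while it tends to
  \<open>0\<close> or to \<open>p(0)\<close> as \<open>t\<close> tends to \<open>0\<close>.\<close>

lemma homogeneous_poly_like:
  assumes "poly_like f" "euler f = of_int n * f" "n \<le> 0"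
  shows "\<exists>c. f = const c \<and> (n < 0 \<longrightarrow> c = 0)"
proof -
  from assms(1) obtain p where p: "p \<in> poly_funs" and f: "\<And>Z. qnorm Z \<noteq> 0 \<Longrightarrow> ev f Z = p Z"
    by (elim poly_likeE) (rule that)
  have lim: "((\<lambda>t. of_real t powi (- n) * p (msc (of_real t) Z)) \<longlongrightarrow> (if n < 0 then 0 else p 0)) (at_right (0::real))" for Z
  proof -
    have "((\<lambda>t. msc (of_real t) Z) \<longlongrightarrow> msc (of_real 0) Z) (at_right (0::real))"
      unfolding msc_def by (intro tendsto_intros)
    moreover have "msc (of_real 0) Z = 0" by (simp add: msc_def vec_eq_iff)
    ultimately have "((\<lambda>t. p (msc (of_real t) Z)) \<longlongrightarrow> p 0) (at_right (0::real))"
      using isCont_tendsto_compose[OF poly_funs_continuous[OF p]] by metis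
    moreover have "((\<lambda>t. of_real t powi (- n)) \<longlongrightarrow> (if n < 0 then 0 else 1 :: complex)) (at_right (0::real))"
    proof -
      have "((\<lambda>t. of_real t ^ nat (- n)) \<longlongrightarrow> (of_real 0 :: complex) ^ nat (- n)) (at_right (0::real))"
        by (intro tendsto_intros)
      moreover have "of_real t powi (- n) = (of_real t :: complex) ^ nat (- n)" for t
        using assms(3) by (simp add: power_int_def)
      ultimately show ?thesis using assms(3) by (auto simp: power_0_left)
    qed
    ultimately have "((\<lambda>t. of_real t powi (- n) * p (msc (of_real t) Z)) \<longlongrightarrow> (if n < 0 then 0 else 1) * p 0) (at_right (0::real))"
      by (rule tendsto_mult[rotated])
    then show ?thesis by (simp split: if_splits)
  qed
  define c where "c = (if n < 0 then 0 else p 0)"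
  have "ev f Z = c" if Z: "qnorm Z \<noteq> 0" for Z
  proof -
    have "of_real t powi (- n) * p (msc (of_real t) Z) = ev f Z" if "t > 0" for t :: real
    proof -
      have "ev f (msc (of_real t) Z) = of_real t powi n * ev f Z"
        using assms(2) that unfolding euler_iff_homogeneous by simp
      then show ?thesis using that Z by (simp add: f qnorm_msc power_int_minus)
    qed
    then have ev: "eventually (\<lambda>t. of_real t powi (- n) * p (msc (of_real t) Z) = ev f Z) (at_right (0::real))"
      by (auto simp: eventually_at_right_field intro: exI[of _ 1])
    have "((\<lambda>t. ev f Z) \<longlongrightarrow> c) (at_right (0::real))"
      unfolding c_def by (rule Lim_transform_eventually[OF lim ev])
    then show ?thesis by (simp add: tendsto_const_iff)
  qed
  then have "f = const c" by (intro laurent_eqI) (simp add: ev_atoms)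
  then show ?thesis unfolding c_def by auto
qed

text \<open>If \<open>N^(k+1) f\<close> is a polynomial, then so is \<open>\<box>(N^(k+1) f)\<close>, and this is a nonzero multiple
  of \<open>N^k f\<close>. So one factor \<open>N\<close> disappears from the denominator of \<open>f\<close>.\<close>

lemma harmonic_clear:
  assumes "lap f = 0" "euler f = of_int n * f" "int k + 2 + n \<noteq> 0" "poly_like (N ^ Suc k * f)"
  shows "poly_like (N ^ k * f)"
proof -
  define m where "m = int (Suc k) * (int k + 2 + n)"
  have m: "m \<noteq> 0" using assms(3) by (simp add: m_def)
  have "lap (N ^ Suc k * f) = of_int m * (N ^ k * f)"
    unfolding lap_N_power assms(1,2) m_def by (simp add: algebra_simps)
  then have "poly_like (of_int m * (N ^ k * f))" using poly_like_lap[OF assms(4)] by simp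
  then have "poly_like (const (1 / of_int m) * (of_int m * (N ^ k * f)))" by (rule poly_like_scale)
  moreover have "const (1 / of_int m) * of_int m = 1"
    using m by (simp flip: const_of_int const_arith)
  ultimately show ?thesis by (simp add: mult.assoc[symmetric])
qed

lemma harmonic_poly_like:
  assumes "lap f = 0" "euler f = of_int n * f" "n \<ge> -1"
  shows "poly_like f"
proof -
  have "poly_like (N ^ k * f) \<Longrightarrow> poly_like f" for k
    by (induction k) (use harmonic_clear[OF assms(1,2)] assms(3) in auto)
  then show ?thesis using poly_like_clear[of f] by blast
qed

lemma harmonic_neg1: "lap f = 0 \<Longrightarrow> euler f = of_int (-1) * f \<Longrightarrow> f = 0"
  using harmonic_poly_like[of f "-1"] homogeneous_poly_like[of f "-1"] by auto

lemma harmonic_0: "lap f = 0 \<Longrightarrow> euler f = of_int 0 * f \<Longrightarrow> \<exists>c. f = const c"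
  using harmonic_poly_like[of f 0] homogeneous_poly_like[of f 0] by auto

lemma harmonic_neg2:
  assumes "lap f = 0" "euler f = of_int (-2) * f"
  shows "\<exists>c. f = const c * invN"
proof -
  have "poly_like (N ^ Suc k * f) \<Longrightarrow> poly_like (N * f)" for k
  proof (induction k)
    case (Suc k)
    then show ?case using harmonic_clear[OF assms, of "Suc k"] by auto
  qed simp
  moreover obtain k where "poly_like (N ^ k * f)" using poly_like_clear by blast
  moreover have "poly_like (N * f)" if "poly_like f"
  proof -
    from that obtain p where p: "p \<in> poly_funs" "\<And>Z. qnorm Z \<noteq> 0 \<Longrightarrow> ev f Z = p Z"
      by (elim poly_likeE) (rule that)
    show ?thesis by (rule poly_likeI[OF poly_funs.mult[OF poly_funs_qnorm p(1)]]) (simp add: p ev_atoms)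
  qed
  ultimately have "poly_like (N * f)" by (cases k) auto
  moreover have "euler (N * f) = of_int 0 * (N * f)"
    by (simp add: euler_mult euler_N assms(2))
  ultimately obtain c where c: "N * f = const c" using homogeneous_poly_like[of "N * f" 0] by auto
  have "f = (N * f) * invN" by (simp add: algebra_simps flip: mult.assoc)
  then show ?thesis unfolding c by blast
qed

section \<open>Solutions of degree 0 and -1\<close>

lemma const_eq_0: "const c = 0 \<Longrightarrow> c = 0"
proof -
  assume "const c = 0"
  then have "ev (const c) (mat 1) = 0" by simp
  then show "c = 0" by (simp add: ev_atoms det_I)
qed

text \<open>\<open>\<box>f\<close> is harmonic of degree \<open>-2\<close>, so it is \<open>c/N\<close>, and \<open>\<nabla>(c/N) = 0\<close> forces
  \<open>c = 0\<close>. So \<open>f\<close> itself is harmonic, of degree \<open>0\<close>.\<close>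

lemma graded_0_constant:
  assumes "graded 0 f"
  shows "\<exists>c. f = (\<lambda>i. const (c i))"
proof -
  note g = graded_dirac_lap[OF assms]
  have "\<exists>c. lap (f i) = const c * invN" for i
    by (rule harmonic_neg2) (use g in simp_all)
  then obtain c where c: "\<And>i. lap (f i) = const (c i) * invN" by metis
  \<comment> \<open>The equation \<open>\<nabla>(c/N) = 0\<close>, multiplied by \<open>N\<^sup>2\<close>.\<close>
  have 0: "const (c 1) * pdiff 1 i N + const (c 2) * pdiff 2 i N = 0" for i
  proof -
    have "nabla_box f i = - (invN * invN * (const (c 1) * pdiff 1 i N + const (c 2) * pdiff 2 i N))"
      unfolding dirac_def sum_2 c by (simp add: pdiff_invN algebra_simps)
    then have "N * (N * (invN * (invN * (const (c 1) * pdiff 1 i N + const (c 2) * pdiff 2 i N)))) = 0"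
      by (simp add: g mult.assoc)
    moreover have "N * (N * (invN * (invN * h))) = (N * invN) * ((N * invN) * h)" for h
      by (simp only: mult_ac)
    ultimately show ?thesis by simp
  qed
  \<comment> \<open>For \<open>i = 1\<close> the left-hand side is linear in the entries of \<open>Z\<close>; its coefficients are its derivatives.\<close>
  have "pdiff 2 2 (const (c 1) * pdiff 1 1 N + const (c 2) * pdiff 2 1 N) = const (c 1)"
    "pdiff 1 2 (const (c 1) * pdiff 1 1 N + const (c 2) * pdiff 2 1 N) = const (- c 2)"
    by (simp_all add: N_def pdiff_entry const_arith)
  then have "c 1 = 0" "c 2 = 0" unfolding 0 using const_eq_0[of "c 1"] const_eq_0[of "- c 2"] by auto
  then have "c i = 0" for i using exhaust_2[of i] by auto
  then have "lap (f i) = 0" for i using c by simp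
  moreover have "euler (f i) = of_int 0 * f i" for i using assms by (simp add: graded_def)
  ultimately have "\<exists>c. f i = const c" for i by (intro harmonic_0) auto
  then show ?thesis by metis
qed

text \<open>The column \<open>Z k / N(Z)\<close>, the image of the constant column \<open>-k\<close> under the group element
  \<open>(0, 1; 1, 0)\<close>, which inverts \<open>Z\<close>.\<close>

definition Zcol :: "(2 \<Rightarrow> complex) \<Rightarrow> col" where
  "Zcol k i = (\<Sum>j\<in>UNIV. entry i j * (const (k j) * invN))"

text \<open>In the computations below, a factor \<open>N\<close> obtained from products of entries has to cancel against
  one power of its inverse; this fact does it in one step once the difference is exhibited.\<close>

lemma invN_sub: "invN - invN * invN * N = 0"
  by (simp add: mult.assoc mult.commute[of invN N])

lemma dirac_Zcol: "dirac (Zcol k) i = const (k i) * invN"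
proof -
  have "dirac (Zcol k) i = const (k i) * invN + const (k i) * (invN - invN * invN * N)"
    by (rule cases_2[of i]; simp add: Zcol_def operator_defs pdiff_invN[unfolded N_def] algebra_simps)
  then show ?thesis unfolding invN_sub by simp
qed

lemma conformal_Zcol: "conformal_op c d (Zcol k) = 0"
proof
  fix i
  have "conformal_op c d (Zcol k) i = entry d c * (\<Sum>j\<in>UNIV. entry i j * const (k j)) * (invN - invN * invN * N)"
    by (rule cases_2[of i]; rule cases_2[of c]; rule cases_2[of d]; simp add: Zcol_def operator_defs pdiff_invN[unfolded N_def] algebra_simps)
  then show "conformal_op c d (Zcol k) i = 0 i" unfolding invN_sub by simp
qed

lemma right_Zcol: "c \<noteq> d \<Longrightarrow> right_op c d (Zcol k) = Zcol (\<lambda>i. if i = c then k d else 0)"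
proof
  fix i assume cd: "c \<noteq> d"
  show "right_op c d (Zcol k) i = Zcol (\<lambda>i. if i = c then k d else 0) i"
    by (rule cases_2[of i]; rule cases_2[of c]; rule cases_2[of d]; use cd in \<open>simp add: Zcol_def operator_defs pdiff_invN[unfolded N_def] algebra_simps\<close>)
qed

lemma euler_invN: "euler invN = of_int (-2) * invN"
proof -
  have "euler invN = - (invN * invN * euler N)"
    by (simp add: euler_def pdiff_invN sum_2 algebra_simps)
  also have "\<dots> = 2 * (invN - invN * invN * N) - 2 * invN" by (simp add: euler_N algebra_simps)
  finally show ?thesis unfolding invN_sub by simp
qed

lemma euler_const: "euler (const c) = 0"
  by (simp add: euler_def)

lemma euler_Zcol: "euler (Zcol k i) = of_int (-1) * Zcol k i"
  by (simp add: Zcol_def sum_2 linear_ops euler_mult euler_entry euler_invN euler_const algebra_simps)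

lemma graded_Zcol: "graded (-1) (Zcol k)"
proof -
  have "lap (const (k i) * invN) = 0" for i
  proof -
    have "lap invN = (pdiff 1 1 N * pdiff 2 2 N - pdiff 1 2 N * pdiff 2 1 N) * 2 * invN * invN * invN
       - (pdiff 1 1 (pdiff 2 2 N) - pdiff 1 2 (pdiff 2 1 N)) * invN * invN"
      by (simp add: lap_def pdiff_invN algebra_simps)
    also have "\<dots> = - (2 * invN * (invN - invN * invN * N))"
      by (simp add: N_def pdiff_entry algebra_simps)
    finally show ?thesis unfolding invN_sub by (simp add: linear_ops)
  qed
  moreover have "nabla_box (Zcol k) i = lap (dirac (Zcol k) i)" for i
    by (simp add: dirac_def lap_pdiff linear_ops sum_2)
  ultimately show ?thesis unfolding graded_def quasi_def using euler_Zcol by (simp add: dirac_Zcol)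
qed

text \<open>\<open>\<nabla>f\<close> is harmonic of degree \<open>-2\<close>, so it has the form \<open>2 k/N\<close>, which is also
  \<open>\<nabla>(Z k/N)\<close>. The difference is annihilated by \<open>\<nabla>\<close>, hence harmonic of degree \<open>-1\<close>, hence zero.\<close>

lemma graded_neg1_Zcol:
  assumes "graded (-1) f"
  shows "\<exists>k. f = Zcol k"
proof -
  note g = graded_dirac_lap[OF assms]
  have "\<exists>c. dirac f i = const c * invN" for i
    by (rule harmonic_neg2) (use g in simp_all)
  then obtain k where k: "\<And>i. dirac f i = const (k i) * invN" by metis
  have "dirac (f - Zcol k) i = 0" for i
  proof -
    have "dirac (f - Zcol k) i = dirac f i - dirac (Zcol k) i" by (simp add: dirac_def sum_2)
    then show ?thesis by (simp add: k dirac_Zcol)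
  qed
  then have "lap ((f - Zcol k) i) = 0" for i by (rule dirac_zero_imp_lap_zero)
  moreover have "euler ((f - Zcol k) i) = of_int (-1) * (f - Zcol k) i" for i
    using assms euler_Zcol[of k i] by (simp add: graded_def linear_ops)
  ultimately have "(f - Zcol k) i = 0" for i by (rule harmonic_neg1)
  then have "f = Zcol k" by auto
  then show ?thesis by blast
qed

section \<open>The infinitesimal left action\<close>

text \<open>The differentiated left action. The expansion over matrix units shows its effect on degrees;
  the form with \<open>vfield\<close> and \<open>mfield\<close> below is the one that arises by differentiation and that
  makes the commutator manageable.\<close>

definition act :: "glh \<Rightarrow> col \<Rightarrow> col" where
  "act X f i = (\<Sum>c\<in>UNIV. \<Sum>d\<in>UNIV.
      const (X $ (1, c) $ (1, d)) * left_op c d f i - const (X $ (1, c) $ (2, d)) * pdiff c d (f i)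
    + const (X $ (2, c) $ (1, d)) * conformal_op c d f i + const (X $ (2, c) $ (2, d)) * right_op c d f i)"

text \<open>With \<open>(A, B; C, D)\<close> the blocks of \<open>X\<close>, this is the entry \<open>(a, b)\<close> of
  \<open>Z D - A Z - B + Z C Z\<close>.\<close>

definition vfield :: "glh \<Rightarrow> 2 \<Rightarrow> 2 \<Rightarrow> laurent" where
  "vfield X a b = (\<Sum>d\<in>UNIV. entry a d * const (X $ (2, d) $ (2, b)) - const (X $ (1, a) $ (1, d)) * entry d b)
     - const (X $ (1, a) $ (2, b)) + (\<Sum>c\<in>UNIV. \<Sum>d\<in>UNIV. entry a c * const (X $ (2, c) $ (1, d)) * entry d b)"

text \<open>The matrix \<open>M - tr M\<close> for \<open>M = A - Z C\<close>.\<close>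

definition mfield :: "glh \<Rightarrow> 2 \<Rightarrow> 2 \<Rightarrow> laurent" where
  "mfield X i j = const (X $ (1, i) $ (1, j)) - (\<Sum>c\<in>UNIV. entry i c * const (X $ (2, c) $ (1, j)))
     - (if i = j then \<Sum>c\<in>UNIV. const (X $ (1, c) $ (1, c)) - (\<Sum>d\<in>UNIV. entry c d * const (X $ (2, d) $ (1, c))) else 0)"

definition dir :: "(2 \<Rightarrow> 2 \<Rightarrow> laurent) \<Rightarrow> laurent \<Rightarrow> laurent" where
  "dir v f = (\<Sum>a\<in>UNIV. \<Sum>b\<in>UNIV. v a b * pdiff a b f)"

lemma act_eq: "act X f i = dir (vfield X) (f i) + (\<Sum>j\<in>UNIV. mfield X i j * f j)"
  by (rule cases_2[of i]; simp add: act_def dir_def vfield_def mfield_def operator_defs algebra_simps)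

text \<open>The second-order terms cancel because the derivations commute.\<close>

lemma first_order_bracket:
  fixes V V' M M' :: "2 \<Rightarrow> 2 \<Rightarrow> laurent" and f :: col
  defines "R \<equiv> \<lambda>f i. dir V (f i) + (\<Sum>j\<in>UNIV. M i j * f j)"
    and "R' \<equiv> \<lambda>f i. dir V' (f i) + (\<Sum>j\<in>UNIV. M' i j * f j)"
  shows "R (R' f) i - R' (R f) i = dir (\<lambda>a b. dir V (V' a b) - dir V' (V a b)) (f i)
    + (\<Sum>j\<in>UNIV. (dir V (M' i j) - dir V' (M i j) + (\<Sum>k\<in>UNIV. M i k * M' k j - M' i k * M k j)) * f j)"
  unfolding R_def R'_def by (simp add: dir_def sum_2 algebra_simps)

lemma sum_pairs: "(\<Sum>p\<in>UNIV. g p) = g (1, 1) + g (1, 2) + g (2, 1) + g (2::2, 2::2)"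
proof -
  have "(\<Sum>p\<in>UNIV. g p) = (\<Sum>i\<in>UNIV. \<Sum>k\<in>UNIV. g (i, k))"
    by (simp add: sum.cartesian_product)
  then show ?thesis by (simp add: sum_2 add.assoc)
qed

lemma bracket_entry: "(X ** Y - Y ** X) $ p $ q = (\<Sum>r\<in>UNIV. X $ p $ r * Y $ r $ q) - (\<Sum>r\<in>UNIV. Y $ p $ r * X $ r $ q)"
  by (simp add: matrix_matrix_mult_def)

lemma one_neq_two: "((1::2) = 2) = False" "((2::2) = 1) = False"
  by simp_all

lemma dir_entry: "dir v (entry a b) = v a b"
  by (rule cases_2[of a]; rule cases_2[of b]; simp add: dir_def sum_2 pdiff_entry)

lemma dir_simps: "dir v (f + g) = dir v f + dir v g" "dir v (f - g) = dir v f - dir v g"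
  "dir v (f * g) = dir v f * g + f * dir v g" "dir v (const c) = 0" "dir v 0 = 0"
  by (simp_all add: dir_def sum_2 algebra_simps)

text \<open>The two actions of \<open>X\<close> and \<open>Y\<close> on points by fractional linear transformations have the vector
  field of the commutator as their bracket. Evaluated at a point, the claim is an identity between
  polynomials in the entries of \<open>Z\<close>, \<open>X\<close> and \<open>Y\<close>.\<close>

lemma vfield_bracket: "vfield (X ** Y - Y ** X) a b = dir (vfield X) (vfield Y a b) - dir (vfield Y) (vfield X a b)"
proof -
  have "dir v (vfield Y a b) = (\<Sum>d\<in>UNIV. v a d * const (Y $ (2, d) $ (2, b)) - const (Y $ (1, a) $ (1, d)) * v d b)
     + (\<Sum>c\<in>UNIV. \<Sum>d\<in>UNIV. v a c * const (Y $ (2, c) $ (1, d)) * entry d b + entry a c * const (Y $ (2, c) $ (1, d)) * v d b)" for v Y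
    by (simp add: vfield_def sum_2 dir_simps dir_entry)
  note * = this
  show ?thesis
    unfolding * unfolding vfield_def bracket_entry sum_pairs sum_2
    by (rule laurent_eqI, simp only: ev_simps ev_atoms not_False_eq_True, algebra)
qed

lemma dir_mfield: "dir v (mfield Y i j) = - (\<Sum>c\<in>UNIV. v i c * const (Y $ (2, c) $ (1, j)))
     + (if i = j then \<Sum>c\<in>UNIV. \<Sum>d\<in>UNIV. v c d * const (Y $ (2, d) $ (1, c)) else 0)"
  by (simp add: mfield_def sum_2 dir_simps dir_entry)

lemma mfield_bracket: "mfield (X ** Y - Y ** X) i j = dir (vfield X) (mfield Y i j) - dir (vfield Y) (mfield X i j)
   + (\<Sum>k\<in>UNIV. mfield X i k * mfield Y k j - mfield Y i k * mfield X k j)"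
proof -
  have "\<forall>i j. mfield (X ** Y - Y ** X) i j = dir (vfield X) (mfield Y i j) - dir (vfield Y) (mfield X i j)
   + (\<Sum>k\<in>UNIV. mfield X i k * mfield Y k j - mfield Y i k * mfield X k j)"
    unfolding dir_mfield
    unfolding forall_2 mfield_def vfield_def bracket_entry sum_pairs sum_2 if_True if_False one_neq_two simp_thms
    by (intro conjI; rule laurent_eqI; simp only: ev_simps ev_atoms not_False_eq_True; algebra)
  then show ?thesis by blast
qed

lemma act_bracket: "act (X ** Y - Y ** X) f = act X (act Y f) - act Y (act X f)"
proof
  fix i
  have *: "act X f = (\<lambda>i. dir (vfield X) (f i) + (\<Sum>j\<in>UNIV. mfield X i j * f j))" for X f
    by (rule ext) (rule act_eq)
  show "act (X ** Y - Y ** X) f i = (act X (act Y f) - act Y (act X f)) i"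
    unfolding fun_diff_def * first_order_bracket vfield_bracket mfield_bracket by (simp add: dir_def sum_2)
qed

lemma dir_scale: "dir v (const c * f) = const c * dir v f"
  by (simp add: dir_def sum_2 algebra_simps)

lemma act_add: "act X (f + g) = act X f + act X g"
  by (rule ext) (simp add: act_eq dir_simps sum_2 algebra_simps)

lemma act_scale: "act X (cscale c f) = cscale c (act X f)"
  by (rule ext) (simp add: act_eq dir_scale cscale_def sum_2 algebra_simps)

lemma act_matrix_add: "act (X + Y) f = act X f + act Y f"
  by (rule ext) (simp add: act_def sum_2 const_arith algebra_simps)

lemma act_matrix_scale: "act (msc c X) f = cscale c (act X f)"
  by (rule ext) (simp add: act_def cscale_def msc_def sum_2 const_arith algebra_simps)

section \<open>Invariant subspaces of columns\<close>

definition glh_unit :: "2 \<times> 2 \<Rightarrow> 2 \<times> 2 \<Rightarrow> glh" where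
  "glh_unit p q = (\<chi> i j. if i = p \<and> j = q then 1 else 0)"

text \<open>The block matrix \<open>diag(1, -1)\<close>: it acts through the Euler operator and thereby separates the
  degrees.\<close>

definition grading :: glh where
  "grading = (\<chi> p q. if p = q then if fst p = 1 then 1 else -1 else 0)"

lemma glh_unit_in_sl: "p \<noteq> q \<Longrightarrow> glh_unit p q \<in> sl"
  by (auto simp: sl_def trace_def glh_unit_def intro!: sum.neutral)

lemma grading_in_sl: "grading \<in> sl"
  by (simp add: sl_def trace_def grading_def sum_pairs)

lemma act_glh_unit:
  "act (glh_unit (1, c) (1, d)) f = left_op c d f" "act (glh_unit (1, c) (2, d)) f = - (\<lambda>i. pdiff c d (f i))"
  "act (glh_unit (2, c) (1, d)) f = conformal_op c d f" "act (glh_unit (2, c) (2, d)) f = right_op c d f"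
  by (rule ext; rule cases_2[of c]; rule cases_2[of d]; simp add: act_def glh_unit_def sum_2)+

lemma act_grading: "act grading f i = - f i - 2 * euler (f i)"
  by (rule cases_2[of i]; simp add: act_def grading_def operator_defs const_arith algebra_simps)

definition invariant :: "col set \<Rightarrow> bool" where
  "invariant W \<longleftrightarrow> col.subspace W \<and> (\<forall>X\<in>sl. \<forall>f\<in>W. act X f \<in> W)"

lemma invariantD:
  assumes "invariant W" "f \<in> W"
  shows "(\<lambda>i. pdiff c d (f i)) \<in> W" "conformal_op c d f \<in> W" "c \<noteq> d \<Longrightarrow> left_op c d f \<in> W" "c \<noteq> d \<Longrightarrow> right_op c d f \<in> W"
    "(\<lambda>i. euler (f i)) \<in> W"
proof -
  have W: "col.subspace W" and X: "\<And>X. X \<in> sl \<Longrightarrow> act X f \<in> W" using assms unfolding invariant_def by auto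
  have "act (glh_unit (1, c) (2, d)) f \<in> W" by (rule X[OF glh_unit_in_sl]) simp
  then have "- (\<lambda>i. pdiff c d (f i)) \<in> W" by (simp add: act_glh_unit)
  from col.subspace_neg[OF W this] show "(\<lambda>i. pdiff c d (f i)) \<in> W" by simp
  show "conformal_op c d f \<in> W" unfolding act_glh_unit(3)[symmetric] by (rule X[OF glh_unit_in_sl]) simp
  show "left_op c d f \<in> W" if "c \<noteq> d" unfolding act_glh_unit(1)[symmetric] by (rule X[OF glh_unit_in_sl]) (simp add: that)
  show "right_op c d f \<in> W" if "c \<noteq> d" unfolding act_glh_unit(4)[symmetric] by (rule X[OF glh_unit_in_sl]) (simp add: that)
  have "(\<lambda>i. of_int 2 * euler (f i)) = - f - act grading f" by (rule ext) (simp add: act_grading)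
  also have "\<dots> \<in> W" by (intro col.subspace_diff[OF W] col.subspace_neg[OF W] assms X grading_in_sl)
  finally show "(\<lambda>i. euler (f i)) \<in> W" by (rule subspace_int_cancel[OF W, rotated]) simp
qed

lemma sum_apply: "(\<Sum>n\<in>S. F n) i = (\<Sum>n\<in>S. F n i)" for F :: "'a \<Rightarrow> col"
  by (induction S rule: infinite_finite_induct) auto

lemma euler_sum: "euler (\<Sum>n\<in>S. g n) = (\<Sum>n\<in>S. euler (g n))"
  by (induction S rule: infinite_finite_induct) (auto simp: linear_ops)

text \<open>The Euler operator has distinct eigenvalues on the summands; subtracting \<open>m f\<close> from
  \<open>euler f\<close> removes the summand of degree \<open>m\<close> and multiplies the others by nonzero integers.\<close>

lemma homogeneous_components:
  assumes "invariant W" "finite S" "\<forall>n\<in>S. graded n (F n)" "(\<Sum>n\<in>S. F n) \<in> W" "n \<in> S"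
  shows "F n \<in> W"
  using assms(2-5)
proof (induction S arbitrary: F n rule: finite_induct)
  case (insert m S)
  have W: "col.subspace W" using assms(1) by (simp add: invariant_def)
  define f where "f = (\<Sum>n\<in>insert m S. F n)"
  have f: "f \<in> W" using insert.prems(2) unfolding f_def .
  define G where "G = (\<lambda>n i. of_int (n - m) * F n i)"
  have E: "euler (F n i) = of_int n * F n i" if "n \<in> insert m S" for n i
    using insert.prems(1) that unfolding graded_def by blast
  have "(\<lambda>i. euler (f i)) - (\<lambda>i. of_int m * f i) = (\<Sum>n\<in>S. G n)"
  proof
    fix i
    have "((\<lambda>i. euler (f i)) - (\<lambda>i. of_int m * f i)) i = (\<Sum>n\<in>insert m S. euler (F n i) - of_int m * F n i)"
      unfolding f_def by (simp only: fun_diff_def sum_apply euler_sum sum_distrib_left sum_subtractf)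
    also have "\<dots> = (\<Sum>n\<in>insert m S. G n i)"
      by (rule sum.cong[OF refl]) (simp only: E, simp add: G_def algebra_simps)
    also have "\<dots> = (\<Sum>n\<in>S. G n i)" using insert.hyps by (simp add: G_def)
    finally show "((\<lambda>i. euler (f i)) - (\<lambda>i. of_int m * f i)) i = (\<Sum>n\<in>S. G n) i" by (simp only: sum_apply)
  qed
  moreover have "(\<lambda>i. euler (f i)) - (\<lambda>i. of_int m * f i) \<in> W"
    by (intro col.subspace_diff[OF W] invariantD(5)[OF assms(1)] subspace_int_mult[OF W] f)
  ultimately have sum: "(\<Sum>n\<in>S. G n) \<in> W" by simp
  have gr: "\<forall>n\<in>S. graded n (G n)"
    using insert.prems(1) graded_scale[of _ _ "of_int (_ - m)"] unfolding G_def const_of_int by blast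
  have S: "F n \<in> W" if n: "n \<in> S" for n
  proof (rule subspace_int_cancel[OF W])
    show "n - m \<noteq> 0" using n insert.hyps by auto
    show "(\<lambda>i. of_int (n - m) * F n i) \<in> W" using insert.IH[OF gr sum n] by (simp add: G_def)
  qed
  have "F m = f - (\<Sum>n\<in>S. F n)" using insert.hyps by (simp add: f_def)
  moreover have "f - (\<Sum>n\<in>S. F n) \<in> W" by (intro col.subspace_diff[OF W] f col.subspace_sum[OF W] S)
  ultimately have "F m \<in> W" by simp
  then show ?case using S insert.prems(3) by blast
qed simp

text \<open>The defining representation of \<open>sl(2)\<close> is irreducible: the two nilpotent matrix units move any
  nonzero vector to multiples of both basis vectors.\<close>

lemma two_dim_irreducible:
  fixes \<phi> :: "(2 \<Rightarrow> complex) \<Rightarrow> col"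
  assumes W: "col.subspace W"
    and lin: "\<And>k l. \<phi> (\<lambda>i. k i + l i) = \<phi> k + \<phi> l" "\<And>c k. \<phi> (\<lambda>i. c * k i) = cscale c (\<phi> k)"
    and inv: "\<And>c d k. c \<noteq> d \<Longrightarrow> \<phi> k \<in> W \<Longrightarrow> \<phi> (\<lambda>i. if i = c then k d else 0) \<in> W"
    and k: "\<phi> k \<in> W" "k \<noteq> (\<lambda>_. 0)"
  shows "\<phi> l \<in> W"
proof -
  have e: "\<phi> (\<lambda>i. if i = c then z else 0) \<in> W" if "\<phi> m \<in> W" "c \<noteq> d" "m d \<noteq> 0" for c d m z
  proof -
    have "cscale (z / m d) (\<phi> (\<lambda>i. if i = c then m d else 0)) \<in> W"
      by (intro col.subspace_scale[OF W] inv that)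
    then show ?thesis using that(3) by (simp add: lin(2)[symmetric] if_distrib cong: if_cong)
  qed
  obtain d where d: "k d \<noteq> 0" using k(2) by auto
  define c :: 2 where "c = (if d = 1 then 2 else 1)"
  have cd: "c \<noteq> d" "\<And>i. i = c \<or> i = d" using exhaust_2[of d] exhaust_2 unfolding c_def by auto
  have 1: "\<phi> (\<lambda>i. if i = c then z else 0) \<in> W" for z by (rule e[OF k(1) cd(1) d])
  have 2: "\<phi> (\<lambda>i. if i = d then z else 0) \<in> W" for z by (rule e[OF 1[of 1] cd(1)[symmetric]]) simp
  have "l = (\<lambda>i. (if i = c then l c else 0) + (if i = d then l d else 0))"
    using cd by (auto simp: fun_eq_iff)
  then have "\<phi> l = \<phi> (\<lambda>i. if i = c then l c else 0) + \<phi> (\<lambda>i. if i = d then l d else 0)"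
    using lin(1)[of "\<lambda>i. if i = c then l c else 0" "\<lambda>i. if i = d then l d else 0"] by simp
  then show ?thesis using col.subspace_add[OF W 1 2] by simp
qed

text \<open>A solution of positive degree that all lowering operators annihilate has all derivatives zero,
  so Euler's equation makes it vanish.\<close>

lemma nonneg_lower:
  assumes "invariant W" "graded (int n) f" "f \<in> W" "f \<noteq> 0"
  shows "\<exists>g. graded 0 g \<and> g \<in> W \<and> g \<noteq> 0"
  using assms(2-4)
proof (induction n arbitrary: f)
  case (Suc n)
  have "\<exists>c d. (\<lambda>i. pdiff c d (f i)) \<noteq> 0"
  proof (rule ccontr)
    assume "\<not> ?thesis"
    then have "pdiff c d (f i) = 0" for c d i unfolding fun_eq_iff zero_fun_def by blast
    then have "euler (f i) = 0" for i by (simp add: euler_def)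
    moreover have "euler (f i) = of_int (int (Suc n)) * f i" for i using Suc.prems(1) unfolding graded_def by blast
    ultimately have "of_int (int (Suc n)) * f i = of_int (int (Suc n)) * 0" for i by simp
    then have "f i = 0" for i by (rule of_int_cancel[rotated]) simp
    then show False using Suc.prems(3) by auto
  qed
  then obtain c d where cd: "(\<lambda>i. pdiff c d (f i)) \<noteq> 0" by blast
  moreover have "graded (int n) (\<lambda>i. pdiff c d (f i))" using graded_pdiff[OF Suc.prems(1), of c d] by simp
  moreover have "(\<lambda>i. pdiff c d (f i)) \<in> W" by (rule invariantD[OF assms(1) Suc.prems(2)])
  ultimately show ?case using Suc.IH by blast
qed auto

text \<open>Here the counterpart of Euler's equation is the injectivity of \<open>raise_lower\<close>.\<close>

lemma neg_raise:
  assumes "invariant W" "graded (- 1 - int n) f" "f \<in> W" "f \<noteq> 0"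
  shows "\<exists>g. graded (-1) g \<and> g \<in> W \<and> g \<noteq> 0"
  using assms(2-4)
proof (induction n arbitrary: f)
  case (Suc n)
  have "\<exists>c d. conformal_op c d f \<noteq> 0"
  proof (rule ccontr)
    assume "\<not> ?thesis"
    then have "conformal_op c d f = 0" for c d by blast
    then have "raise_lower f = 0" by (auto simp: raise_lower_def fun_eq_iff)
    then show False using raise_lower_kernel[OF Suc.prems(1)] Suc.prems(3) by simp
  qed
  then obtain c d where cd: "conformal_op c d f \<noteq> 0" by blast
  moreover have "graded (- 1 - int n) (conformal_op c d f)" using graded_conformal[OF Suc.prems(1), of c d] by simp
  moreover have "conformal_op c d f \<in> W" by (rule invariantD[OF assms(1) Suc.prems(2)])
  ultimately show ?case using Suc.IH by blast
qed auto

lemma lower_raise_in: "invariant W \<Longrightarrow> (\<And>c d. (\<lambda>i. pdiff c d (f i)) \<in> W) \<Longrightarrow> lower_raise f \<in> W"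
proof -
  assume W: "invariant W" and f: "\<And>c d. (\<lambda>i. pdiff c d (f i)) \<in> W"
  have "lower_raise f = (\<Sum>c\<in>UNIV. \<Sum>d\<in>UNIV. conformal_op c d (\<lambda>j. pdiff d c (f j)))"
    by (rule ext) (simp add: lower_raise_def sum_2)
  then show ?thesis using W unfolding invariant_def
    by (auto intro!: col.subspace_sum invariantD[OF W] f)
qed

lemma raise_lower_in: "invariant W \<Longrightarrow> (\<And>c d. conformal_op c d f \<in> W) \<Longrightarrow> raise_lower f \<in> W"
proof -
  assume W: "invariant W" and f: "\<And>c d. conformal_op c d f \<in> W"
  have "raise_lower f = (\<Sum>c\<in>UNIV. \<Sum>d\<in>UNIV. (\<lambda>i. pdiff d c (conformal_op c d f i)))"
    by (rule ext) (simp add: raise_lower_def sum_2)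
  then show ?thesis using W unfolding invariant_def
    by (auto intro!: col.subspace_sum invariantD[OF W] f)
qed

text \<open>Descend from a nonzero element to a constant, obtain all constants, and climb back degree by
  degree with \<open>lower_raise_preimage\<close>.\<close>

theorem nonneg_irreducible:
  assumes W: "invariant W" and f: "graded m f" "m \<ge> 0" "f \<in> W" "f \<noteq> 0"
    and g: "graded n g" "n \<ge> 0"
  shows "g \<in> W"
proof -
  have sub: "col.subspace W" using W by (simp add: invariant_def)
  obtain h where h: "graded 0 h" "h \<in> W" "h \<noteq> 0"
    using nonneg_lower[OF W, of "nat m" f] f by auto
  obtain k where k: "h = (\<lambda>i. const (k i))" using graded_0_constant[OF h(1)] by blast
  have const: "(\<lambda>i. const (l i)) \<in> W" for l
  proof (rule two_dim_irreducible[OF sub, where \<phi> = "\<lambda>k i. const (k i)" and k = k])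
    fix c d :: 2 and k assume cd: "c \<noteq> d" and "(\<lambda>i. const (k i)) \<in> W"
    then have "left_op c d (\<lambda>i. const (k i)) \<in> W" using invariantD[OF W] by blast
    moreover have "left_op c d (\<lambda>i. const (k i)) = (\<lambda>i. const (if i = c then k d else 0))"
      using cd by (auto simp: left_op_def fun_eq_iff)
    ultimately show "(\<lambda>i. const (if i = c then k d else 0)) \<in> W" by simp
  next
    show "k \<noteq> (\<lambda>_. 0)" using h(3) k by auto
    show "(\<lambda>i. const (k i)) \<in> W" using h(2) k by simp
  qed (auto simp: const_arith cscale_def fun_eq_iff)
  have "\<forall>g. graded (int n) g \<longrightarrow> g \<in> W" for n
  proof (induction n)
    case 0
    show ?case using graded_0_constant const by fastforce
  next
    case (Suc n)
    show ?case
    proof (intro allI impI)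
      fix g assume g: "graded (int (Suc n)) g"
      show "g \<in> W"
      proof (rule lower_raise_preimage[OF sub g])
        fix h assume h: "graded (int (Suc n)) h"
        show "lower_raise h \<in> W"
        proof (rule lower_raise_in[OF W])
          fix c d
          have "graded (int n) (\<lambda>i. pdiff c d (h i))" using graded_pdiff[OF h, of c d] by simp
          then show "(\<lambda>i. pdiff c d (h i)) \<in> W" using Suc.IH by blast
        qed
      qed simp
    qed
  qed
  from this[of "nat n"] g show ?thesis by simp
qed

lemma Zcol_linear: "Zcol (\<lambda>i. k i + l i) = Zcol k + Zcol l" "Zcol (\<lambda>i. c * k i) = cscale c (Zcol k)"
  by (auto simp: Zcol_def cscale_def sum_2 const_arith fun_eq_iff algebra_simps)

text \<open>The same argument upside down, starting from degree \<open>-1\<close>.\<close>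

theorem neg_irreducible:
  assumes W: "invariant W" and f: "graded m f" "m < 0" "f \<in> W" "f \<noteq> 0"
    and g: "graded n g" "n < 0"
  shows "g \<in> W"
proof -
  have sub: "col.subspace W" using W by (simp add: invariant_def)
  obtain h where h: "graded (-1) h" "h \<in> W" "h \<noteq> 0"
    using neg_raise[OF W, of "nat (- 1 - m)" f] f by auto
  obtain k where k: "h = Zcol k" using graded_neg1_Zcol[OF h(1)] by blast
  have Z: "Zcol l \<in> W" for l
  proof (rule two_dim_irreducible[OF sub Zcol_linear, where k = k])
    fix c d :: 2 and k assume cd: "c \<noteq> d" and "Zcol k \<in> W"
    then have "right_op c d (Zcol k) \<in> W" using invariantD[OF W] by blast
    then show "Zcol (\<lambda>i. if i = c then k d else 0) \<in> W" by (simp add: right_Zcol[OF cd])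
  next
    have "Zcol (\<lambda>_. 0) = 0" by (auto simp: Zcol_def fun_eq_iff)
    then show "k \<noteq> (\<lambda>_. 0)" using h(3) k by auto
    show "Zcol k \<in> W" using h(2) k by simp
  qed
  have "\<forall>g. graded (- 1 - int n) g \<longrightarrow> g \<in> W" for n
  proof (induction n)
    case 0
    show ?case using graded_neg1_Zcol Z by fastforce
  next
    case (Suc n)
    show ?case
    proof (intro allI impI)
      fix g assume g: "graded (- 1 - int (Suc n)) g"
      show "g \<in> W"
      proof (rule raise_lower_preimage[OF sub g])
        fix h assume h: "graded (- 1 - int (Suc n)) h"
        show "raise_lower h \<in> W"
        proof (rule raise_lower_in[OF W])
          fix c d
          have "graded (- 1 - int n) (conformal_op c d h)" using graded_conformal[OF h, of c d] by simp
          then show "conformal_op c d h \<in> W" using Suc.IH by blast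
        qed
      qed simp
    qed
  qed
  from this[of "nat (- 1 - n)"] g show ?thesis by simp
qed

section \<open>Differentials of the group actions\<close>

lemma bounded_bilinear_matrix_mult:
  "bounded_bilinear ((**) :: complex^'n^'m \<Rightarrow> complex^'p^'n \<Rightarrow> complex^'p^'m)"
proof -
  have "bilinear ((**) :: complex^'n^'m \<Rightarrow> complex^'p^'n \<Rightarrow> complex^'p^'m)"
    unfolding bilinear_def
    by (auto intro!: linearI simp: vec_eq_iff matrix_matrix_mult_def sum.distrib distrib_left distrib_right scaleR_sum_right)
  then show ?thesis by (simp add: bilinear_conv_bounded_bilinear)
qed

lemma matrix_inv_inverse:
  fixes A :: "'a::field^'n^'n"
  assumes "det A \<noteq> 0"
  shows "A ** matrix_inv A = mat 1" "matrix_inv A ** A = mat 1"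
proof -
  have "\<exists>A'. A ** A' = mat 1 \<and> A' ** A = mat 1"
    using assms invertible_det_nz invertible_def by blast
  then have "A ** matrix_inv A = mat 1 \<and> matrix_inv A ** A = mat 1"
    unfolding matrix_inv_def by (rule someI_ex)
  then show "A ** matrix_inv A = mat 1" "matrix_inv A ** A = mat 1" by auto
qed

lemma matrix_inv_mat_1: "matrix_inv (mat 1 :: 'a::field^'n^'n) = mat 1"
  using matrix_inv_inverse(1)[of "mat 1 :: 'a^'n^'n"] by (simp add: det_I)

text \<open>With \<open>J = A^(-1)\<close> and \<open>E = A - 1\<close> one has \<open>J = 1 - J E\<close>. So \<open>J\<close> stays bounded for small
  \<open>E\<close>, and \<open>J - 1 + E = J E E\<close> is quadratically small.\<close>

lemma has_derivative_matrix_inv: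
  "((matrix_inv :: complex^'n^'n \<Rightarrow> complex^'n^'n) has_derivative (\<lambda>X. - X)) (at (mat 1))"
proof -
  interpret mm: bounded_bilinear "(**) :: complex^'n^'n \<Rightarrow> complex^'n^'n \<Rightarrow> complex^'n^'n"
    by (rule bounded_bilinear_matrix_mult)
  have "\<exists>C>0. \<forall>(A :: complex^'n^'n) (B :: complex^'n^'n). norm (A ** B) \<le> norm A * norm B * C"
    by (rule mm.pos_bounded)
  then obtain C where C0: "C > 0 \<and> (\<forall>(A :: complex^'n^'n) (B :: complex^'n^'n). norm (A ** B) \<le> norm A * norm B * C)"
    by (elim exE)
  then have C: "C > 0" "norm (A ** B) \<le> norm A * norm B * C" for A B :: "complex^'n^'n" by simp_all
  have "continuous_on UNIV (\<lambda>A::complex^'n^'n. det A)"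
    unfolding det_def
    by (intro continuous_on_sum continuous_on_mult continuous_on_const continuous_on_prod
      has_derivative_continuous_on[OF has_derivative_entry])
  then have "open {A::complex^'n^'n. det A \<noteq> 0}"
    by (intro open_Collect_neq continuous_on_const)
  moreover have "(mat 1 :: complex^'n^'n) \<in> {A. det A \<noteq> 0}" by (simp add: det_I)
  ultimately obtain e where e: "e > 0" "ball (mat 1) e \<subseteq> {A::complex^'n^'n. det A \<noteq> 0}"
    by (rule openE)
  define H where "H = (\<lambda>A::complex^'n^'n. (2 * norm (mat 1 :: complex^'n^'n) * C * C) * norm (A - mat 1))"
  show ?thesis
  proof (rule has_derivativeI_sandwich[where e = "min e (1 / (2 * C))" and H = H])
    show "0 < min e (1 / (2 * C))" using e C by simp
    show "bounded_linear (\<lambda>X::complex^'n^'n. - X)" by (rule bounded_linear_minus[OF bounded_linear_ident])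
    have "(H \<longlongrightarrow> (2 * norm (mat 1 :: complex^'n^'n) * C * C) * norm (mat 1 - mat 1 :: complex^'n^'n)) (at (mat 1))"
      unfolding H_def by (intro tendsto_intros)
    then show "(H \<longlongrightarrow> 0) (at (mat 1))" by simp
    fix A :: "complex^'n^'n" assume A: "A \<noteq> mat 1" "dist A (mat 1) < min e (1 / (2 * C))"
    define E J where "E = A - mat 1" and "J = matrix_inv A"
    have "A \<in> ball (mat 1) e" using A by (simp add: dist_commute)
    then have "det A \<noteq> 0" using e(2) by auto
    then have J: "J ** A = mat 1" unfolding J_def by (rule matrix_inv_inverse)
    have A_eq: "A = mat 1 + E" by (simp add: E_def)
    have "J + J ** E = mat 1" using J unfolding A_eq mm.add_right by simp
    then have 1: "J = mat 1 - J ** E" by (simp add: eq_diff_eq)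
    have E: "norm E * C \<le> 1 / 2" using A C by (simp add: E_def dist_norm field_simps)
    have "norm J \<le> norm (mat 1 :: complex^'n^'n) + norm (J ** E)"
      by (subst 1) (rule norm_triangle_ineq4)
    also have "norm (J ** E) \<le> norm J * (norm E * C)" using C(2)[of J E] by (simp add: mult.assoc)
    also have "\<dots> \<le> norm J * (1 / 2)" using E by (intro mult_left_mono) auto
    finally have J2: "norm J \<le> 2 * norm (mat 1 :: complex^'n^'n)" by simp
    have 2: "mat 1 - J = J ** E" using 1 by (simp add: algebra_simps)
    have "J - mat 1 + E = E - J ** E" using 2 by (simp add: algebra_simps)
    also have "\<dots> = (mat 1 - J) ** E" by (simp add: mm.diff_left)
    also have "\<dots> = (J ** E) ** E" by (simp only: 2)
    finally have "norm (J - mat 1 + E) \<le> norm (J ** E) * norm E * C" using C(2)[of "J ** E" E] by simp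
    also have "\<dots> \<le> (norm J * norm E * C) * norm E * C"
      using C by (intro mult_right_mono) auto
    also have "\<dots> \<le> (2 * norm (mat 1 :: complex^'n^'n) * norm E * C) * norm E * C"
      using C J2 by (intro mult_right_mono) auto
    also have "\<dots> = H A * norm E" by (simp add: H_def E_def)
    finally have "norm (J - mat 1 + E) \<le> H A * norm E" .
    moreover have "norm E > 0" using A by (simp add: E_def)
    ultimately show "norm (matrix_inv A - matrix_inv (mat 1) - - (A - mat 1)) / norm (A - mat 1) \<le> H A"
      unfolding matrix_inv_mat_1 J_def[symmetric] E_def[symmetric] by (simp add: divide_le_eq)
  qed
qed

lemma has_derivative_vec_lambda:
  fixes c :: "'i::finite \<Rightarrow> 'a::real_normed_vector \<Rightarrow> complex"
  assumes "\<And>i. (c i has_derivative c' i) F"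
  shows "((\<lambda>h. \<chi> i. c i h) has_derivative (\<lambda>X. \<chi> i. c' i X)) F"
proof -
  have lin: "bounded_linear (axis i :: complex \<Rightarrow> complex^'i)" for i
    by (rule linear_conv_bounded_linear[THEN iffD1]) (auto intro!: linearI simp: axis_def vec_eq_iff)
  have e: "(\<chi> i. d i) = (\<Sum>i\<in>UNIV. axis i (d i))" for d :: "'i \<Rightarrow> complex"
    by (simp add: vec_eq_iff axis_def if_distrib cong: if_cong)
  show ?thesis unfolding e
    by (intro has_derivative_sum bounded_linear.has_derivative[OF lin] assms)
qed

definition emb :: "col \<Rightarrow> hfun" where
  "emb g = (\<lambda>Z. \<chi> i. ev (g i) Z)"

lemma mat_1_entries:
  "(mat 1 :: hc) $ 1 $ 1 = 1" "(mat 1 :: hc) $ 1 $ 2 = 0" "(mat 1 :: hc) $ 2 $ 1 = 0" "(mat 1 :: hc) $ 2 $ 2 = 1"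
  by (simp_all add: mat_def)

text \<open>Both group actions have this form: a point \<open>A h\<close> that moves with \<open>h\<close>, and a matrix \<open>J h\<close>,
  the unit matrix at \<open>h = 1\<close>, divided by its norm. There the derivative of the norm is a trace, which explains the shape of \<open>mfield\<close>.\<close>

lemma has_derivative_cocycle:
  fixes J A J' A' :: "glh \<Rightarrow> hc"
  assumes J: "(J has_derivative J') (at x)" and A: "(A has_derivative A') (at x)"
    and x: "J x = mat 1" "A x = Z" and Z: "qnorm Z \<noteq> 0"
  shows "((\<lambda>h. \<chi> i. \<Sum>j\<in>UNIV. 1 / qnorm (J h) * J h $ i $ j * ev (g j) (A h)) has_derivative
    (\<lambda>X. \<chi> i. (\<Sum>a\<in>UNIV. \<Sum>b\<in>UNIV. A' X $ a $ b * ev (pdiff a b (g i)) Z) +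
       (\<Sum>j\<in>UNIV. (J' X $ i $ j - (if i = j then J' X $ 1 $ 1 + J' X $ 2 $ 2 else 0)) * ev (g j) Z))) (at x)"
proof (rule has_derivative_vec_lambda)
  fix i
  have e: "((\<lambda>h. J h $ i $ j) has_derivative (\<lambda>X. J' X $ i $ j)) (at x)" for i j
    by (rule has_derivative_compose[OF J has_derivative_entry])
  have J1: "J x $ 1 $ 1 = 1" "J x $ 1 $ 2 = 0" "J x $ 2 $ 1 = 0" "J x $ 2 $ 2 = 1"
    by (simp_all add: x mat_1_entries)
  have "((\<lambda>h. qnorm (J h)) has_derivative (\<lambda>X. J' X $ 1 $ 1 + J' X $ 2 $ 2)) (at x)"
    unfolding det_2
    by (rule has_derivative_eq_rhs[OF has_derivative_diff[OF has_derivative_mult[OF e e] has_derivative_mult[OF e e]]])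
      (simp add: J1 add.commute)
  moreover have "((\<lambda>z. 1 / z) has_derivative (*) (- 1)) (at (qnorm (J x)))"
    unfolding has_field_derivative_def[symmetric] by (auto intro!: derivative_eq_intros simp: x det_I)
  ultimately have s: "((\<lambda>h. 1 / qnorm (J h)) has_derivative (\<lambda>X. - 1 * (J' X $ 1 $ 1 + J' X $ 2 $ 2))) (at x)"
    by (rule has_derivative_compose)
  have g: "((\<lambda>h. ev (g j) (A h)) has_derivative
      (\<lambda>X. \<Sum>a\<in>UNIV. \<Sum>b\<in>UNIV. A' X $ a $ b * ev (pdiff a b (g j)) Z)) (at x)" for j
    using has_derivative_compose[OF A has_gradient_ev[of "A x" "g j"]] Z unfolding x by blast
  show "((\<lambda>h. \<Sum>j\<in>UNIV. 1 / qnorm (J h) * J h $ i $ j * ev (g j) (A h)) has_derivative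
    (\<lambda>X. (\<Sum>a\<in>UNIV. \<Sum>b\<in>UNIV. A' X $ a $ b * ev (pdiff a b (g i)) Z) +
       (\<Sum>j\<in>UNIV. (J' X $ i $ j - (if i = j then J' X $ 1 $ 1 + J' X $ 2 $ 2 else 0)) * ev (g j) Z))) (at x)"
    by (rule has_derivative_eq_rhs[OF has_derivative_sum[OF has_derivative_mult[OF has_derivative_mult[OF s e] g]]], rule cases_2[of i])
      (simp_all add: fun_eq_iff x mat_1_entries det_I sum_2 algebra_simps)
qed

lemma linear_has_derivative:
  fixes L :: "glh \<Rightarrow> hc"
  shows "linear L \<Longrightarrow> (L has_derivative L) F"
  by (simp add: bounded_linear_imp_has_derivative linear_conv_bounded_linear)

lemmas linear_simps = blk_def vec_eq_iff matrix_matrix_mult_def sum_2 algebra_simps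

lemma linear_left: "linear (\<lambda>h. blk 1 1 h - Z ** blk 2 1 h)" "linear (\<lambda>h. - blk 1 2 h + Z ** blk 2 2 h)"
  by (auto intro!: linearI simp: linear_simps)

lemma linear_right: "linear (\<lambda>h. blk 2 1 h ** Z + blk 2 2 h)" "linear (\<lambda>h. blk 1 1 h ** Z + blk 1 2 h)"
  by (auto intro!: linearI simp: linear_simps)

lemma blk_mat_1: "blk i j (mat 1) = (if i = j then mat 1 else 0)"
  by (auto simp: blk_def mat_def vec_eq_iff)

lemma has_derivative_matrix_mult:
  fixes A B :: "glh \<Rightarrow> hc"
  assumes "(A has_derivative A') (at x)" "(B has_derivative B') (at x)"
  shows "((\<lambda>h. A h ** B h) has_derivative (\<lambda>X. A x ** B' X + A' X ** B x)) (at x)"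
  by (rule bounded_bilinear.FDERIV[OF bounded_bilinear_matrix_mult assms])

lemma has_derivative_matrix_inv_compose:
  fixes A :: "glh \<Rightarrow> hc"
  assumes "(A has_derivative A') (at x)" "A x = mat 1"
  shows "((\<lambda>h. matrix_inv (A h)) has_derivative (\<lambda>X. - A' X)) (at x)"
  using has_derivative_compose[OF assms(1), of matrix_inv "\<lambda>X. - X"] has_derivative_matrix_inv assms(2) by simp

lemma ev_fields:
  assumes Z: "qnorm Z \<noteq> 0"
  shows "ev (vfield X a b) Z = (- blk 1 2 X + Z ** blk 2 2 X - (blk 1 1 X - Z ** blk 2 1 X) ** Z) $ a $ b"
    "ev (mfield X i j) Z = (blk 1 1 X - Z ** blk 2 1 X) $ i $ j - (if i = j then (blk 1 1 X - Z ** blk 2 1 X) $ 1 $ 1 + (blk 1 1 X - Z ** blk 2 1 X) $ 2 $ 2 else 0)"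
  by (simp_all add: vfield_def mfield_def sum_2 ev_atoms[OF Z] blk_def matrix_matrix_mult_def algebra_simps)

text \<open>The maps \<open>h \<mapsto> a' - Z c'\<close> and \<open>h \<mapsto> - b' + Z d'\<close> are linear, hence their own
  derivatives.\<close>

lemma differential_pi_left: "differential pi_left X (emb g) = emb (act X g)"
proof
  fix Z :: hc
  show "differential pi_left X (emb g) Z = emb (act X g) Z"
  proof (cases "qnorm Z = 0")
    case True
    then show ?thesis by (simp add: differential_def emb_def ev_sing vec_eq_iff)
  next
    case Z: False
    define J W where "J = (\<lambda>h. blk 1 1 h - Z ** blk 2 1 h)" and "W = (\<lambda>h. - blk 1 2 h + Z ** blk 2 2 h)"
    have J: "(J has_derivative J) (at (mat 1))" and W: "(W has_derivative W) (at (mat 1))"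
      unfolding J_def W_def by (rule linear_has_derivative[OF linear_left(1)]) (rule linear_has_derivative[OF linear_left(2)])
    have 1: "J (mat 1) = mat 1" "W (mat 1) = Z" by (simp_all add: J_def W_def blk_mat_1)
    have A: "((\<lambda>h. matrix_inv (J h) ** W h) has_derivative (\<lambda>X. W X - J X ** Z)) (at (mat 1))"
      by (rule has_derivative_eq_rhs[OF has_derivative_matrix_mult[OF has_derivative_matrix_inv_compose[OF J 1(1)] W]])
        (simp add: 1 matrix_inv_mat_1 fun_eq_iff linear_simps forall_2 mat_1_entries)
    have "((\<lambda>h. pi_left h (emb g) Z) has_derivative (\<lambda>X. emb (act X g) Z)) (at (mat 1))"
    proof (rule has_derivative_eq_rhs)
      have "(\<lambda>h. pi_left h (emb g) Z) = (\<lambda>h. \<chi> i. \<Sum>j\<in>UNIV. 1 / qnorm (J h) * J h $ i $ j * ev (g j) (matrix_inv (J h) ** W h))"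
        by (simp add: fun_eq_iff pi_left_def Let_def J_def W_def matrix_vector_mult_def msc_def emb_def vec_eq_iff)
      then show "((\<lambda>h. pi_left h (emb g) Z) has_derivative (\<lambda>X. \<chi> i. (\<Sum>a\<in>UNIV. \<Sum>b\<in>UNIV. (W X - J X ** Z) $ a $ b * ev (pdiff a b (g i)) Z) +
       (\<Sum>j\<in>UNIV. (J X $ i $ j - (if i = j then J X $ 1 $ 1 + J X $ 2 $ 2 else 0)) * ev (g j) Z))) (at (mat 1))"
        using has_derivative_cocycle[OF J A 1(1) _ Z] 1 by (simp add: matrix_inv_mat_1)
      show "(\<lambda>X. \<chi> i. (\<Sum>a\<in>UNIV. \<Sum>b\<in>UNIV. (W X - J X ** Z) $ a $ b * ev (pdiff a b (g i)) Z) +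
       (\<Sum>j\<in>UNIV. (J X $ i $ j - (if i = j then J X $ 1 $ 1 + J X $ 2 $ 2 else 0)) * ev (g j) Z)) = (\<lambda>X. emb (act X g) Z)"
        unfolding emb_def act_eq dir_def sum_2 ev_simps ev_fields[OF Z] J_def W_def by simp
    qed
    from frechet_derivative_at[OF this] show ?thesis using Z by (metis differential_def)
  qed
qed

section \<open>The differential operators on functions\<close>

lemma emb_simps: "emb (f + g) = emb f + emb g" "emb (cscale c f) = fscale c (emb f)" "emb 0 = 0"
proof -
  show "emb (f + g) = emb f + emb g" "emb 0 = 0"
    by (auto simp: emb_def fun_eq_iff vec_eq_iff)
  show "emb (cscale c f) = fscale c (emb f)"
  proof
    fix Z show "emb (cscale c f) Z = fscale c (emb f) Z"
      by (cases "qnorm Z = 0") (simp_all add: emb_def fscale_def cscale_def vec_eq_iff ev_sing ev_atoms)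
  qed
qed

lemma emb_diff: "emb (f - g) = emb f - emb g"
  by (auto simp: emb_def fun_eq_iff vec_eq_iff)

lemma emb_inject: "emb f = emb g \<longleftrightarrow> f = g"
proof
  assume *: "emb f = emb g"
  have "f i = g i" for i
  proof (rule laurent_eqI)
    fix Z show "ev (f i) Z = ev (g i) Z" using fun_cong[OF *, of Z] by (simp add: emb_def vec_eq_iff)
  qed
  then show "f = g" by (rule ext)
qed simp

lemma emb_surj:
  assumes "\<And>i. (\<lambda>Z. F Z $ i) \<in> laurent_funs"
  shows "\<exists>g. F = emb g"
proof -
  have "ev (Abs_laurent h) = h" if "h \<in> laurent_funs" for h
    using that by (simp add: ev.rep_eq Abs_laurent_inverse)
  then have "F = emb (\<lambda>i. Abs_laurent (\<lambda>Z. F Z $ i))"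
    using assms by (auto simp: emb_def fun_eq_iff vec_eq_iff)
  then show ?thesis by blast
qed

lemma emb_laurent: "(\<lambda>Z. emb g Z $ i) \<in> laurent_funs"
proof -
  have "ev f \<in> laurent_funs" for f by transfer
  then show ?thesis by (simp add: emb_def)
qed

text \<open>The operators on functions take arbitrary values at singular matrices, so they can only be
  compared with ring elements on the domain \<open>N(Z) \<noteq> 0\<close>.\<close>

definition agree :: "hfun \<Rightarrow> col \<Rightarrow> bool" where
  "agree F g \<longleftrightarrow> (\<forall>Z. qnorm Z \<noteq> 0 \<longrightarrow> F Z = emb g Z)"

text \<open>The derivative along the basis vector \<open>qe j\<close>.\<close>

definition coord_diff :: "nat \<Rightarrow> laurent \<Rightarrow> laurent" where
  "coord_diff j f = (\<Sum>a\<in>UNIV. \<Sum>b\<in>UNIV. const (qe j $ a $ b) * pdiff a b f)"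

lemma agree_pd:
  assumes "agree F g"
  shows "agree (pd j F) (\<lambda>i. coord_diff j (g i))"
  unfolding agree_def
proof (intro allI impI)
  fix Z :: hc assume Z: "qnorm Z \<noteq> 0"
  have Z0: "Z + msc 0 B = Z" for B :: hc by (simp add: msc_def vec_eq_iff)
  have "deriv (\<lambda>t. F (Z + msc t (qe j)) $ i) 0 = ev (coord_diff j (g i)) Z" for i
  proof (rule DERIV_imp_deriv)
    have "continuous_on UNIV (\<lambda>t. qnorm (Z + msc t (qe j)))"
      unfolding det_2 by (simp add: msc_def) (intro continuous_intros)
    then have S: "open {t. qnorm (Z + msc t (qe j)) \<noteq> 0}"
      by (intro open_Collect_neq continuous_on_const)
    have "((\<lambda>t. ev (g i) (Z + msc t (qe j))) has_field_derivative ev (coord_diff j (g i)) Z) (at 0)"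
      using has_field_derivative_line[of Z 0 "qe j" "g i"] Z
      by (simp add: Z0 coord_diff_def sum_2 ev_atoms)
    then show "((\<lambda>t. F (Z + msc t (qe j)) $ i) has_field_derivative ev (coord_diff j (g i)) Z) (at 0)"
      by (rule has_field_derivative_transform_within_open[OF _ S]) (use assms Z in \<open>auto simp: agree_def emb_def Z0\<close>)
  qed
  then show "pd j F Z = emb (\<lambda>i. coord_diff j (g i)) Z" by (simp add: pd_def emb_def)
qed

lemma const_i: "const \<i> * const \<i> = -1" "const \<i> * (const \<i> * f) = - f"
  by (simp_all flip: const_arith mult.assoc) (simp_all add: const_arith)

lemma coord_diff_simps: "coord_diff 0 f = pdiff 1 1 f + pdiff 2 2 f" "coord_diff (Suc 0) f = - const \<i> * (pdiff 1 2 f + pdiff 2 1 f)"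
  "coord_diff 2 f = pdiff 2 1 f - pdiff 1 2 f" "coord_diff 3 f = const \<i> * (pdiff 2 2 f - pdiff 1 1 f)"
  by (simp_all add: coord_diff_def qe_def mat_def sum_2 const_arith algebra_simps)

lemma coord_diff_box: "(\<Sum>j<4. coord_diff j (coord_diff j f)) = 4 * lap f"
proof -
  have "{..<4} = {0, 1, 2, 3 :: nat}" by auto
  then have "(\<Sum>j<4. coord_diff j (coord_diff j f)) = coord_diff 0 (coord_diff 0 f) + coord_diff 1 (coord_diff 1 f) + coord_diff 2 (coord_diff 2 f) + coord_diff 3 (coord_diff 3 f)"
    by (simp add: add.assoc)
  then show ?thesis by (simp add: coord_diff_simps const_i lap_def algebra_simps)
qed

lemma agree_box:
  assumes "agree F g"
  shows "agree (box F) (\<lambda>i. 4 * lap (g i))"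
  unfolding agree_def
proof (intro allI impI)
  fix Z :: hc assume Z: "qnorm Z \<noteq> 0"
  have "pd j (pd j F) Z = emb (\<lambda>i. coord_diff j (coord_diff j (g i))) Z" for j
    using agree_pd[OF agree_pd[OF assms], of j j] Z unfolding agree_def by blast
  then have "box F Z = (\<Sum>j<4. emb (\<lambda>i. coord_diff j (coord_diff j (g i))) Z)" by (simp add: box_def)
  also have "\<dots> = emb (\<lambda>i. \<Sum>j<4. coord_diff j (coord_diff j (g i))) Z"
    by (simp add: emb_def vec_eq_iff eval_nat_numeral(2,3) lessThan_Suc)
  finally show "box F Z = emb (\<lambda>i. 4 * lap (g i)) Z" unfolding coord_diff_box .
qed

definition dirac_right :: "col \<Rightarrow> col" where
  "dirac_right f i = (\<Sum>j\<in>UNIV. pdiff i j (f j))"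

lemma qe_entries: "qe 0 = mat 1" "qe 1 = vector [vector [0, -\<i>], vector [-\<i>, 0]]"
  "qe 2 = vector [vector [0, -1], vector [1, 0]]" "qe 3 = vector [vector [-\<i>, 0], vector [0, \<i>]]"
  by (simp_all add: qe_def)

lemma i_i_mult: "\<i> * (\<i> * z) = - z" by (simp flip: mult.assoc)

lemma agree_nabla:
  assumes "agree F g"
  shows "agree (nabla F) (\<lambda>i. 2 * dirac g i)" "agree (nabla_right F) (\<lambda>i. 2 * dirac_right g i)"
proof -
  have "nabla F Z = emb (\<lambda>i. 2 * dirac g i) Z \<and> nabla_right F Z = emb (\<lambda>i. 2 * dirac_right g i) Z"
    if Z: "qnorm Z \<noteq> 0" for Z
  proof -
    have pd: "pd j F Z = emb (\<lambda>i. coord_diff j (g i)) Z" for j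
      using agree_pd[OF assms, of j] Z unfolding agree_def by blast
    have two: "ev 2 Z = 2" using ev_atoms(2)[OF Z, of 2] by simp
    show ?thesis
      unfolding nabla_def nabla_right_def pd qe_entries
      by (simp add: emb_def vec_eq_iff forall_2 matrix_vector_mult_def vector_matrix_mult_def sum_2 mat_1_entries
         coord_diff_simps[simplified] dirac_def dirac_right_def ev_atoms[OF Z] two i_i_mult algebra_simps)
  qed
  then show "agree (nabla F) (\<lambda>i. 2 * dirac g i)" "agree (nabla_right F) (\<lambda>i. 2 * dirac_right g i)"
    by (simp_all add: agree_def)
qed

lemma agree_emb: "agree (emb g) g"
  by (simp add: agree_def)

lemma vanish_iff: "(\<forall>Z. qnorm Z \<noteq> 0 \<longrightarrow> emb g Z = 0) \<longleftrightarrow> g = 0"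
proof
  assume *: "\<forall>Z. qnorm Z \<noteq> 0 \<longrightarrow> emb g Z = 0"
  have "emb g = emb 0"
  proof
    fix Z show "emb g Z = emb 0 Z"
      using * by (cases "qnorm Z = 0") (auto simp: emb_simps, simp add: emb_def ev_sing vec_eq_iff)
  qed
  then show "g = 0" by (simp add: emb_inject)
qed (simp add: emb_simps)

lemma eight_mult_eq_0: "8 * f = (0 :: laurent) \<longleftrightarrow> f = 0"
  using of_int_cancel[of 8 f 0] by auto

lemma U_left_emb: "U_left = emb ` {g. quasi g}"
proof -
  have "emb g \<in> U_left \<longleftrightarrow> quasi g" for g
  proof -
    have "agree (nabla (box (emb g))) (\<lambda>i. 2 * dirac (\<lambda>j. 4 * lap (g j)) i)"
      by (intro agree_nabla agree_box agree_emb)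
    moreover have "(\<lambda>i. 2 * dirac (\<lambda>j. 4 * lap (g j)) i) = (\<lambda>i. 2 * (4 * nabla_box g i))"
      by (simp add: fun_eq_iff dirac_def sum_2 algebra_simps)
    ultimately have "(\<forall>Z. qnorm Z \<noteq> 0 \<longrightarrow> nabla (box (emb g)) Z = 0) \<longleftrightarrow> (\<lambda>i. 2 * (4 * nabla_box g i)) = 0"
      unfolding vanish_iff[symmetric] by (simp add: agree_def)
    then show ?thesis
      by (simp add: U_left_def emb_laurent quasi_def fun_eq_iff eight_mult_eq_0)
  qed
  moreover have "\<exists>g. f = emb g" if "f \<in> U_left" for f
    using that by (intro emb_surj) (auto simp: U_left_def)
  ultimately show ?thesis by (auto simp: image_iff) blast
qed

lemma U_right_emb: "U_right = emb ` {g. \<forall>i. dirac_right (\<lambda>j. lap (g j)) i = 0}"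
proof -
  have "emb g \<in> U_right \<longleftrightarrow> (\<forall>i. dirac_right (\<lambda>j. lap (g j)) i = 0)" for g
  proof -
    have "agree (nabla_right (box (emb g))) (\<lambda>i. 2 * dirac_right (\<lambda>j. 4 * lap (g j)) i)"
      by (intro agree_nabla agree_box agree_emb)
    moreover have "(\<lambda>i. 2 * dirac_right (\<lambda>j. 4 * lap (g j)) i) = (\<lambda>i. 2 * (4 * dirac_right (\<lambda>j. lap (g j)) i))"
      by (simp add: fun_eq_iff dirac_right_def sum_2 algebra_simps)
    ultimately have "(\<forall>Z. qnorm Z \<noteq> 0 \<longrightarrow> nabla_right (box (emb g)) Z = 0) \<longleftrightarrow> (\<lambda>i. 2 * (4 * dirac_right (\<lambda>j. lap (g j)) i)) = 0"
      unfolding vanish_iff[symmetric] by (simp add: agree_def)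
    then show ?thesis
      by (simp add: U_right_def emb_laurent fun_eq_iff eight_mult_eq_0)
  qed
  moreover have "\<exists>g. f = emb g" if "f \<in> U_right" for f
    using that by (intro emb_surj) (auto simp: U_right_def)
  ultimately show ?thesis by (auto simp: image_iff) blast
qed

lemma homogeneous_emb: "homogeneous d (emb g) \<longleftrightarrow> (\<forall>i. euler (g i) = of_int d * g i)"
  unfolding euler_iff_homogeneous homogeneous_def by (auto simp: emb_def vec_eq_iff)

lemma homogeneous_U_left: "{f \<in> U_left. \<exists>d. R d \<and> homogeneous d f} = emb ` {g. \<exists>n. R n \<and> graded n g}"
proof -
  have "emb g \<in> U_left \<longleftrightarrow> quasi g" for g unfolding U_left_emb by (auto simp: image_iff emb_inject)
  then have "emb g \<in> {f \<in> U_left. \<exists>d. R d \<and> homogeneous d f} \<longleftrightarrow> (\<exists>n. R n \<and> graded n g)" for g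
    by (auto simp: homogeneous_emb graded_def)
  moreover have "\<exists>g. f = emb g" if "f \<in> U_left" for f using that unfolding U_left_emb by blast
  ultimately show ?thesis by (auto simp: image_iff) blast
qed

section \<open>The left representations\<close>

text \<open>The span is stable: a matrix unit moves degree \<open>n\<close> to \<open>n - 1\<close>, \<open>n\<close> or \<open>n + 1\<close>, and
  whenever the new degree leaves the range \<open>R\<close>, the result is zero.\<close>

lemma emb_action:
  assumes up: "\<And>n g c d. R n \<Longrightarrow> graded n g \<Longrightarrow> R (n + 1) \<or> conformal_op c d g = 0"
    and down: "\<And>n g c d. R n \<Longrightarrow> graded n g \<Longrightarrow> R (n - 1) \<or> (\<lambda>i. pdiff c d (g i)) = 0"
    and f: "f \<in> hfun.span (emb ` {g. \<exists>n. R n \<and> graded n g})" (is "_ \<in> ?V")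
  shows "\<exists>g. f = emb g \<and> emb (act X g) \<in> ?V"
  using f
proof (induction rule: hfun.span_induct_alt)
  case base
  have "act X 0 = 0" by (rule ext) (simp add: act_eq dir_simps)
  then show ?case using hfun.span_zero by (intro exI[of _ 0]) (simp only: emb_simps simp_thms)
next
  case (step c x y)
  then obtain g n where g: "x = emb g" "R n" "graded n g" by blast
  from step obtain h where h: "y = emb h" "emb (act X h) \<in> ?V" by blast
  have base: "emb u \<in> ?V" if "R m \<and> graded m u \<or> u = 0" for m u
  proof (cases "u = 0")
    case True
    then show ?thesis by (simp only: emb_simps hfun.span_zero)
  next
    case False
    then have "R m" "graded m u" using that by simp_all
    then have "u \<in> {g. \<exists>n. R n \<and> graded n g}" by (intro CollectI exI[of _ m] conjI)
    then show ?thesis by (intro hfun.span_base) (rule imageI)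
  qed
  have parts: "emb (left_op a b g) \<in> ?V" "emb (\<lambda>i. pdiff a b (g i)) \<in> ?V" "emb (conformal_op a b g) \<in> ?V" "emb (right_op a b g) \<in> ?V" for a b
  proof -
    show "emb (left_op a b g) \<in> ?V" "emb (right_op a b g) \<in> ?V"
      by (rule base[of n]; simp add: g graded_left graded_right)+
    show "emb (conformal_op a b g) \<in> ?V"
      using up[OF g(2,3), of a b] by (intro base[of "n + 1"]) (elim disjE; simp add: graded_conformal g)
    show "emb (\<lambda>i. pdiff a b (g i)) \<in> ?V"
      using down[OF g(2,3), of a b] by (intro base[of "n - 1"]) (elim disjE; simp add: graded_pdiff g)
  qed
  have act: "act X g = (\<Sum>a\<in>UNIV. \<Sum>b\<in>UNIV. cscale (X $ (1, a) $ (1, b)) (left_op a b g) + cscale (- X $ (1, a) $ (2, b)) (\<lambda>i. pdiff a b (g i))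
      + cscale (X $ (2, a) $ (1, b)) (conformal_op a b g) + cscale (X $ (2, a) $ (2, b)) (right_op a b g))"
    by (rule ext) (simp add: act_def cscale_def sum_2 const_arith)
  have "emb (act X g) \<in> ?V"
    unfolding act sum_2 emb_simps by (intro hfun.span_add hfun.span_scale parts)
  then have "emb (act X (cscale c g + h)) \<in> ?V"
    unfolding act_add act_scale emb_simps using h(2) by (intro hfun.span_add hfun.span_scale)
  moreover have "fscale c x + y = emb (cscale c g + h)" by (simp add: emb_simps g h)
  ultimately show ?case by blast
qed

lemma emb_decompose:
  assumes "f \<in> hfun.span (emb ` {g. \<exists>n. R n \<and> graded n g})"
  shows "\<exists>S F. finite S \<and> (\<forall>n\<in>S. R n \<and> graded n (F n)) \<and> f = emb (\<Sum>n\<in>S. F n)"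
  using assms
proof (induction rule: hfun.span_induct_alt)
  case base
  have "0 = emb (\<Sum>n\<in>({} :: int set). 0)" by (simp only: sum.empty emb_simps)
  then have "finite {} \<and> (\<forall>n\<in>{}. R n \<and> graded n (0 :: col)) \<and> 0 = emb (\<Sum>n\<in>({} :: int set). 0)"
    by simp
  then show ?case by (intro exI[of _ "{}"] exI[of _ "\<lambda>_::int. 0::col"])
next
  case (step c x y)
  then obtain g n where g: "x = emb g" "R n" "graded n g" by blast
  from step obtain S F where S: "finite S" "\<forall>n\<in>S. R n \<and> graded n (F n)" "y = emb (\<Sum>n\<in>S. F n)" by blast
  \<comment> \<open>The degree \<open>n\<close> may or may not occur in \<open>S\<close> already.\<close>
  define F' where "F' = (\<lambda>m. (if m \<in> S then F m else 0) + (if m = n then cscale c g else 0))"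
  have "(\<Sum>m\<in>insert n S. F' m) = (\<Sum>m\<in>insert n S. if m \<in> S then F m else 0) + (\<Sum>m\<in>insert n S. if m = n then cscale c g else 0)"
    unfolding F'_def by (rule sum.distrib)
  also have "(\<Sum>m\<in>insert n S. if m \<in> S then F m else 0) = (\<Sum>m\<in>S. F m)"
    using S(1) by (intro sum.mono_neutral_cong_right) auto
  also have "(\<Sum>m\<in>insert n S. if m = n then cscale c g else 0) = cscale c g"
    using S(1) by (simp add: sum.delta')
  finally have "fscale c x + y = emb (\<Sum>m\<in>insert n S. F' m)"
    unfolding g(1) S(3) by (simp only: emb_simps add.commute)
  moreover have "R m \<and> graded m (F' m)" if "m \<in> insert n S" for m
    using that g S(2) unfolding F'_def
    by (auto intro!: graded_add graded_zero graded_scale simp: cscale_def)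
  ultimately show ?case using S(1) by blast
qed

text \<open>The transition from the ring to the function spaces, for both ranges of degrees at once.\<close>

theorem left_irreducible:
  assumes up: "\<And>n g c d. R n \<Longrightarrow> graded n g \<Longrightarrow> R (n + 1) \<or> conformal_op c d g = 0"
    and down: "\<And>n g c d. R n \<Longrightarrow> graded n g \<Longrightarrow> R (n - 1) \<or> (\<lambda>i. pdiff c d (g i)) = 0"
    and irr: "\<And>W f g m n. invariant W \<Longrightarrow> graded m f \<Longrightarrow> R m \<Longrightarrow> f \<in> W \<Longrightarrow> f \<noteq> 0 \<Longrightarrow> graded n g \<Longrightarrow> R n \<Longrightarrow> g \<in> W"
    and nontriv: "R k" "graded k u" "u \<noteq> 0"
    and L: "sl \<subseteq> L"
  shows "irreducible_lie_rep L (differential pi_left) (hfun.span (emb ` {g. \<exists>n. R n \<and> graded n g}))"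
    (is "irreducible_lie_rep L _ ?V")
proof -
  have V: "\<exists>g. f = emb g \<and> emb (act X g) \<in> ?V" if "f \<in> ?V" for f X
    using emb_action[OF up down that] .
  have rep: "lie_rep L (differential pi_left) ?V"
    unfolding lie_rep_def
  proof (intro conjI ballI allI)
    show "hfun.subspace ?V" by (rule hfun.subspace_span)
    fix X f assume f: "f \<in> ?V"
    from V[OF f, of X] obtain g where g: "f = emb g" "emb (act X g) \<in> ?V" by (elim exE conjE)
    show in_V: "differential pi_left X f \<in> ?V" using g(2) by (simp only: g(1) differential_pi_left)
    show "differential pi_left X (fscale c f) = fscale c (differential pi_left X f)" for c
      by (simp only: g(1) differential_pi_left act_scale emb_simps(1,2)[symmetric])
    show "differential pi_left (msc c X) f = fscale c (differential pi_left X f)" for c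
      by (simp only: g(1) differential_pi_left act_matrix_scale emb_simps(1,2)[symmetric])
    show "differential pi_left (X + Y) f = differential pi_left X f + differential pi_left Y f" for Y
      by (simp only: g(1) differential_pi_left act_matrix_add emb_simps(1,2)[symmetric])
    show "differential pi_left (X ** Y - Y ** X) f
      = differential pi_left X (differential pi_left Y f) - differential pi_left Y (differential pi_left X f)" for Y
      by (simp only: g(1) differential_pi_left act_bracket emb_diff)
    fix f' assume f': "f' \<in> ?V"
    from V[OF f', of X] obtain g' where g': "f' = emb g'" by (elim exE conjE)
    show "differential pi_left X (f + f') = differential pi_left X f + differential pi_left X f'"
      by (simp only: g(1) g' differential_pi_left act_add emb_simps(1,2)[symmetric])
  qed
  have "emb u \<in> ?V" using nontriv by (intro hfun.span_base) blast
  moreover have "emb u \<noteq> 0" using nontriv(3) emb_inject[of u 0] by (simp add: emb_simps)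
  ultimately have "?V \<noteq> {0}" by blast
  moreover have "W = {0} \<or> W = ?V" if W: "hfun.subspace W" "W \<subseteq> ?V" "\<forall>X\<in>L. \<forall>f\<in>W. differential pi_left X f \<in> W" for W
  proof (cases "W = {0}")
    case False
    then obtain f where f: "f \<in> W" "f \<noteq> 0" using hfun.subspace_0[OF W(1)] by blast
    define W' where "W' = {g. emb g \<in> W}"
    have inv: "invariant W'"
      unfolding invariant_def
    proof (intro conjI ballI)
      show "col.subspace W'" unfolding W'_def
        by (rule col.subspaceI) (auto simp: emb_simps hfun.subspace_0 hfun.subspace_add hfun.subspace_scale W(1))
      fix X g assume "X \<in> sl" "g \<in> W'"
      then have "differential pi_left X (emb g) \<in> W" using W(3) L by (auto simp: W'_def)
      then show "act X g \<in> W'" by (simp add: W'_def differential_pi_left)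
    qed
    have "f \<in> ?V" using f(1) W(2) by (rule subsetD[rotated])
    from emb_decompose[OF this] obtain S F
      where S: "finite S" "\<forall>n\<in>S. R n \<and> graded n (F n)" "f = emb (\<Sum>n\<in>S. F n)"
      by (elim exE conjE)
    have "\<exists>n\<in>S. F n \<noteq> 0"
    proof (rule ccontr)
      assume "\<not> ?thesis"
      then have "(\<Sum>n\<in>S. F n) = 0" by (intro sum.neutral) blast
      then show False using f(2) by (simp add: S emb_simps)
    qed
    then obtain n where n: "n \<in> S" "F n \<noteq> 0" by blast
    have Fn: "F n \<in> W'"
    proof (rule homogeneous_components[OF inv S(1) _ _ n(1)])
      show "\<forall>n\<in>S. graded n (F n)" using S(2) by simp
      show "(\<Sum>n\<in>S. F n) \<in> W'" using f(1) unfolding S(3) W'_def by simp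
    qed
    have "emb ` {g. \<exists>n. R n \<and> graded n g} \<subseteq> W"
    proof
      fix x assume "x \<in> emb ` {g. \<exists>n. R n \<and> graded n g}"
      then obtain g m where g: "x = emb g" "R m" "graded m g" by blast
      have "graded n (F n)" "R n" using S(2) n(1) by simp_all
      then have "g \<in> W'" by (rule irr[OF inv _ _ Fn n(2) g(3,2)])
      then show "x \<in> W" by (simp add: g W'_def)
    qed
    then have "?V \<subseteq> W" using W(1) by (rule hfun.span_minimal)
    then show ?thesis using W(2) by blast
  qed simp
  ultimately show ?thesis unfolding irreducible_lie_rep_def using rep by blast
qed

theorem left_nonneg:
  assumes "sl \<subseteq> L"
  shows "irreducible_lie_rep L (differential pi_left) (nonneg_part U_left)"
proof -
  have "irreducible_lie_rep L (differential pi_left) (hfun.span (emb ` {g. \<exists>n. n \<ge> 0 \<and> graded n g}))"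
  proof (rule left_irreducible[OF _ _ _ _ _ _ assms])
    fix n :: int and g c d assume n: "n \<ge> 0" "graded n g"
    show "n + 1 \<ge> 0 \<or> conformal_op c d g = 0" using n by simp
    show "n - 1 \<ge> 0 \<or> (\<lambda>i. pdiff c d (g i)) = 0"
    proof (cases "n = 0")
      case True
      then obtain k where "g = (\<lambda>i. const (k i))" using graded_0_constant n by blast
      then show ?thesis by (simp add: fun_eq_iff)
    qed (use n in simp)
  next
    show "g \<in> W" if "invariant W" "graded m f" "0 \<le> m" "f \<in> W" "f \<noteq> 0" "graded n g" "0 \<le> n" for W f g m n
      by (rule nonneg_irreducible[OF that])
    show "graded 0 (\<lambda>i. const 1)"
      by (simp add: graded_def quasi_def dirac_def lap_def euler_def)
    show "(\<lambda>i::2. const 1) \<noteq> 0" by (simp add: fun_eq_iff)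
  qed simp
  then show ?thesis
    unfolding nonneg_part_def using homogeneous_U_left[of "\<lambda>n. n \<ge> 0"] by simp
qed

lemma Zcol_nonzero: "Zcol (\<lambda>_. 1) \<noteq> 0"
proof
  assume "Zcol (\<lambda>_. 1) = 0"
  then have "ev (Zcol (\<lambda>_. 1) 1) (mat 1) = 0" by simp
  then show False by (simp add: Zcol_def sum_2 ev_atoms det_I mat_1_entries)
qed

theorem left_neg:
  assumes "sl \<subseteq> L"
  shows "irreducible_lie_rep L (differential pi_left) (neg_part U_left)"
proof -
  have "irreducible_lie_rep L (differential pi_left) (hfun.span (emb ` {g. \<exists>n. n < 0 \<and> graded n g}))"
  proof (rule left_irreducible[OF _ _ _ _ graded_Zcol Zcol_nonzero assms])
    fix n :: int and g c d assume n: "n < 0" "graded n g"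
    show "n - 1 < 0 \<or> (\<lambda>i. pdiff c d (g i)) = 0" using n by simp
    show "n + 1 < 0 \<or> conformal_op c d g = 0"
    proof (cases "n = -1")
      case True
      then obtain k where "g = Zcol k" using graded_neg1_Zcol n by blast
      then show ?thesis by (simp add: conformal_Zcol)
    qed (use n in simp)
  next
    show "g \<in> W" if "invariant W" "graded m f" "m < 0" "f \<in> W" "f \<noteq> 0" "graded n g" "n < 0" for W f g m n
      by (rule neg_irreducible[OF that])
  qed simp
  then show ?thesis
    unfolding neg_part_def using homogeneous_U_left[of "\<lambda>n. n < 0"] by simp
qed

section \<open>The right representations\<close>

lemma poly_funs_transpose: "p \<in> poly_funs \<Longrightarrow> (\<lambda>Z. p (transpose Z)) \<in> poly_funs"
proof (induction rule: poly_funs.induct)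
  case (coord j)
  have t: "transpose Z $ a $ b = Z $ b $ a" for Z :: hc and a b by (simp add: transpose_def)
  show ?case
  proof (cases "j = 2")
    case True
    have "(\<lambda>Z. coord j (transpose Z)) = (\<lambda>Z. - coord 2 Z)"
      by (simp add: True coord_def t fun_eq_iff field_simps)
    then show ?thesis using poly_funs_uminus[OF poly_funs.coord[of 2]] by simp
  next
    case False
    with coord have "j = 0 \<or> j = 1 \<or> j = 3" by linarith
    then have "(\<lambda>Z. coord j (transpose Z)) = coord j"
      by (elim disjE) (simp_all add: coord_def t fun_eq_iff add.commute)
    then show ?thesis using poly_funs.coord[OF coord] by simp
  qed
qed (intro poly_funs.intros; assumption)+

lemma laurent_funs_transpose:
  assumes "f \<in> laurent_funs" shows "(\<lambda>Z. f (transpose Z)) \<in> laurent_funs"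
proof -
  from assms obtain p k where p: "p \<in> poly_funs" and
    f: "\<And>Z. f Z = (if qnorm Z = 0 then 0 else p Z / qnorm Z ^ k)"
    unfolding laurent_funs_def by blast
  show ?thesis by (rule laurent_funsI[OF poly_funs_transpose[OF p], of _ k]) (simp add: f)
qed

text \<open>Transposition of the argument exchanges rows with columns and \<open>\<nabla>\<close> acting from the right
  with \<open>\<nabla>\<close> acting from the left.\<close>

lift_definition swap :: "laurent \<Rightarrow> laurent" is "\<lambda>f Z. f (transpose Z)"
  by (rule laurent_funs_transpose)

lemma ev_swap: "ev (swap f) Z = ev f (transpose Z)"
  by transfer (rule refl)

lemma swap_swap [simp]: "swap (swap f) = f"
  by (rule laurent_eqI) (simp add: ev_swap transpose_transpose)

lemma swap_hom: "swap (f + g) = swap f + swap g" "swap (f - g) = swap f - swap g" "swap 0 = 0"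
  by (rule laurent_eqI; simp add: ev_swap)+

lemma pdiff_swap: "pdiff a b (swap f) = swap (pdiff b a f)"
proof (rule pdiff_eqI)
  fix Z :: hc assume Z: "qnorm Z \<noteq> 0"
  have "linear (transpose :: hc \<Rightarrow> hc)"
    by (auto intro!: linearI simp: transpose_def vec_eq_iff)
  then have t: "((transpose :: hc \<Rightarrow> hc) has_derivative transpose) (at Z)"
    by (simp add: bounded_linear_imp_has_derivative linear_conv_bounded_linear)
  have "qnorm (transpose Z) \<noteq> 0" using Z by simp
  from has_derivative_compose[OF t has_gradient_ev[OF this, of f]]
  have "((\<lambda>Z. ev f (transpose Z)) has_derivative
     (\<lambda>V. \<Sum>a\<in>UNIV. \<Sum>b\<in>UNIV. transpose V $ a $ b * ev (pdiff a b f) (transpose Z))) (at Z)" .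
  moreover have "(\<Sum>a\<in>UNIV. \<Sum>b\<in>UNIV. transpose V $ a $ b * ev (pdiff a b f) (transpose Z)) =
     (\<Sum>a\<in>UNIV. \<Sum>b\<in>UNIV. V $ a $ b * ev (swap (pdiff b a f)) Z)" for V
    by (simp add: sum_2 ev_swap transpose_def algebra_simps)
  moreover have "ev (swap f) = (\<lambda>Z. ev f (transpose Z))" by (rule ext) (rule ev_swap)
  ultimately show "has_gradient (ev (swap f)) (\<lambda>a b. ev (swap (pdiff b a f)) Z) Z" by (simp only:)
qed

lemma lap_swap: "lap (swap f) = swap (lap f)"
  by (simp add: lap_def pdiff_swap swap_hom)

lemma dirac_swap: "dirac (\<lambda>j. swap (f j)) i = swap (dirac_right f i)"
  by (simp add: dirac_def dirac_right_def pdiff_swap swap_hom sum_2)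

definition hswap :: "hfun \<Rightarrow> hfun" where
  "hswap F = (\<lambda>Z. F (transpose Z))"

lemma hswap_emb: "hswap (emb g) = emb (\<lambda>i. swap (g i))"
  by (simp add: hswap_def emb_def ev_swap)

lemma hswap_hswap [simp]: "hswap (hswap F) = F"
  by (simp add: hswap_def)

lemma hswap_linear: "hswap (f + g) = hswap f + hswap g" "hswap (fscale c f) = fscale c (hswap f)"
  "hswap (f - g) = hswap f - hswap g"
  by (auto simp: hswap_def fscale_def fun_eq_iff)

lemma swap_eq_0: "swap f = 0 \<longleftrightarrow> f = 0"
  by (metis swap_swap swap_hom(3))

lemma U_right_eq: "f \<in> U_right \<longleftrightarrow> hswap f \<in> U_left"
proof -
  have "emb g \<in> U_right \<longleftrightarrow> hswap (emb g) \<in> U_left" for g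
    unfolding U_right_emb U_left_emb hswap_emb
    by (simp add: image_iff emb_inject quasi_def lap_swap dirac_swap swap_eq_0)
  moreover have "\<exists>g. f = emb g" if "f \<in> U_right" using that unfolding U_right_emb by blast
  moreover have "\<exists>g. f = emb g" if "hswap f \<in> U_left"
  proof -
    from that obtain g where "hswap f = emb g" unfolding U_left_emb by blast
    then have "f = emb (\<lambda>i. swap (g i))" by (metis hswap_hswap hswap_emb)
    then show ?thesis by blast
  qed
  ultimately show ?thesis by metis
qed

lemma homogeneous_hswap: "homogeneous d (hswap f) \<longleftrightarrow> homogeneous d f"
proof -
  have t: "transpose (msc c Z) = msc c (transpose Z)" for c and Z :: hc
    by (simp add: transpose_def msc_def vec_eq_iff)
  have 1: "homogeneous d (hswap f)" if "homogeneous d f" for f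
    using that unfolding homogeneous_def hswap_def t by blast
  show ?thesis using 1[of f] 1[of "hswap f"] by auto
qed

lemma span_hswap: "hfun.span (hswap ` S) = hswap ` hfun.span S"
proof -
  interpret module_hom fscale fscale hswap
    by unfold_locales (rule hswap_linear)+
  show ?thesis by (rule span_image)
qed

lemma parts_hswap:
  "nonneg_part U_right = hswap ` nonneg_part U_left" "neg_part U_right = hswap ` neg_part U_left"
proof -
  have "{f \<in> U_right. \<exists>d. R d \<and> homogeneous d f} = hswap ` {f \<in> U_left. \<exists>d. R d \<and> homogeneous d f}" for R
  proof (rule set_eqI)
    fix f
    show "f \<in> {f \<in> U_right. \<exists>d. R d \<and> homogeneous d f} \<longleftrightarrow> f \<in> hswap ` {f \<in> U_left. \<exists>d. R d \<and> homogeneous d f}"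
    proof
      assume "f \<in> {f \<in> U_right. \<exists>d. R d \<and> homogeneous d f}"
      then show "f \<in> hswap ` {f \<in> U_left. \<exists>d. R d \<and> homogeneous d f}"
        by (intro image_eqI[of _ _ "hswap f"]) (simp_all add: U_right_eq homogeneous_hswap)
    next
      assume "f \<in> hswap ` {f \<in> U_left. \<exists>d. R d \<and> homogeneous d f}"
      then show "f \<in> {f \<in> U_right. \<exists>d. R d \<and> homogeneous d f}"
        by (elim imageE) (simp add: U_right_eq homogeneous_hswap)
    qed
  qed
  then show "nonneg_part U_right = hswap ` nonneg_part U_left" "neg_part U_right = hswap ` neg_part U_left"
    unfolding nonneg_part_def neg_part_def span_hswap[symmetric] by (simp_all only:)
qed

definition other :: "2 \<Rightarrow> 2" where "other i = (if i = 1 then 2 else 1)"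

text \<open>On blocks, \<open>(A, B; C, D)\<close> goes to \<open>(- D\<^sup>T, B\<^sup>T; C\<^sup>T, - A\<^sup>T)\<close>. This is
  \<open>X \<mapsto> - S X\<^sup>T S\<^sup>-\<^sup>1\<close> with \<open>S = (0, 1; - 1, 0)\<close>, an automorphism of the Lie algebra; it
  describes what transposition of \<open>Z\<close> does to the infinitesimal fractional linear transformations.\<close>

definition theta :: "glh \<Rightarrow> glh" where
  "theta X = (\<chi> p q. (if fst p = fst q then - 1 else 1) * X $ (other (fst q), snd q) $ (other (fst p), snd p))"

lemma other_simps [simp]: "other 1 = 2" "other 2 = 1"
  by (simp_all add: other_def)

lemma theta_linear: "theta (X + Y) = theta X + theta Y" "theta (msc c X) = msc c (theta X)"
  by (simp_all add: theta_def msc_def vec_eq_iff algebra_simps)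

lemma theta_theta: "theta (theta X) = X"
  by (simp add: theta_def vec_eq_iff forall_2)

lemma theta_bracket: "theta (X ** Y - Y ** X) = theta X ** theta Y - theta Y ** theta X"
  unfolding vec_eq_iff split_paired_All forall_2
  by (simp add: theta_def bracket_entry matrix_matrix_mult_def sum_pairs algebra_simps)

lemma theta_sl: "X \<in> sl \<Longrightarrow> theta X \<in> sl"
  by (simp add: sl_def trace_def theta_def sum_pairs algebra_simps add_eq_0_iff)

text \<open>The right action contains \<open>h^(-1)\<close>, whose derivative at the identity is \<open>-X\<close>. The factor
  \<open>c Z + d\<close> acts on rows from the right, so its transpose takes the role of the factor in
  \<open>has_derivative_cocycle\<close>.\<close>

lemma differential_pi_right:
  "differential pi_right X (hswap (emb g)) = hswap (differential pi_left (theta X) (emb g))"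
proof
  fix Z :: hc
  define g' where "g' = (\<lambda>i. swap (g i))"
  show "differential pi_right X (hswap (emb g)) Z = hswap (differential pi_left (theta X) (emb g)) Z"
  proof (cases "qnorm Z = 0")
    case True
    then show ?thesis by (simp add: differential_def hswap_def)
  next
    case Z: False
    define J W where "J = (\<lambda>h. blk 2 1 h ** Z + blk 2 2 h)" and "W = (\<lambda>h. blk 1 1 h ** Z + blk 1 2 h)"
    have inv: "matrix_inv (mat 1 :: glh) = mat 1" by (rule matrix_inv_mat_1)
    have J0: "(J has_derivative J) F" and W0: "(W has_derivative W) F" for F
      unfolding J_def W_def by (rule linear_has_derivative[OF linear_right(1)]) (rule linear_has_derivative[OF linear_right(2)])
    have J: "((\<lambda>h. J (matrix_inv h)) has_derivative (\<lambda>X. J (- X))) (at (mat 1))"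
      by (rule has_derivative_compose[OF has_derivative_matrix_inv]) (rule J0)
    have W: "((\<lambda>h. W (matrix_inv h)) has_derivative (\<lambda>X. W (- X))) (at (mat 1))"
      by (rule has_derivative_compose[OF has_derivative_matrix_inv]) (rule W0)
    have 1: "J (mat 1) = mat 1" "W (mat 1) = Z" by (simp_all add: J_def W_def blk_mat_1)
    have t: "((\<lambda>h. transpose (J (matrix_inv h))) has_derivative (\<lambda>X. transpose (J (- X)))) (at (mat 1))"
    proof -
      have "linear (transpose :: hc \<Rightarrow> hc)"
        by (auto intro!: linearI simp: transpose_def vec_eq_iff)
      then have "((transpose :: hc \<Rightarrow> hc) has_derivative transpose) F" for F
        by (simp add: bounded_linear_imp_has_derivative linear_conv_bounded_linear)
      from has_derivative_compose[OF J this] show ?thesis .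
    qed
    have A: "((\<lambda>h. W (matrix_inv h) ** matrix_inv (J (matrix_inv h))) has_derivative (\<lambda>X. W (- X) - Z ** J (- X))) (at (mat 1))"
      by (rule has_derivative_eq_rhs[OF has_derivative_matrix_mult[OF W has_derivative_matrix_inv_compose[OF J]]])
        (simp_all add: 1 inv matrix_inv_mat_1 fun_eq_iff linear_simps forall_2 mat_1_entries)
    have "((\<lambda>h. pi_right h (emb g') Z) has_derivative (\<lambda>X. emb (act (theta X) g) (transpose Z))) (at (mat 1))"
    proof (rule has_derivative_eq_rhs)
      have "(\<lambda>h. pi_right h (emb g') Z) = (\<lambda>h. \<chi> i. \<Sum>j\<in>UNIV. 1 / qnorm (transpose (J (matrix_inv h))) * transpose (J (matrix_inv h)) $ i $ j
          * ev (g' j) (W (matrix_inv h) ** matrix_inv (J (matrix_inv h))))"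
        by (simp add: fun_eq_iff pi_right_def Let_def J_def W_def vector_matrix_mult_def msc_def emb_def vec_eq_iff)
          (simp add: transpose_def sum_2 mult_ac)
      then show "((\<lambda>h. pi_right h (emb g') Z) has_derivative (\<lambda>X. \<chi> i. (\<Sum>a\<in>UNIV. \<Sum>b\<in>UNIV. (W (- X) - Z ** J (- X)) $ a $ b * ev (pdiff a b (g' i)) Z) +
       (\<Sum>j\<in>UNIV. (transpose (J (- X)) $ i $ j - (if i = j then transpose (J (- X)) $ 1 $ 1 + transpose (J (- X)) $ 2 $ 2 else 0)) * ev (g' j) Z))) (at (mat 1))"
        using has_derivative_cocycle[OF t A _ _ Z, of g'] by (simp only: 1 inv matrix_inv_mat_1 transpose_mat matrix_mul_rid)
      have Zt: "qnorm (transpose Z) \<noteq> 0" using Z by simp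
      show "(\<lambda>X. \<chi> i. (\<Sum>a\<in>UNIV. \<Sum>b\<in>UNIV. (W (- X) - Z ** J (- X)) $ a $ b * ev (pdiff a b (g' i)) Z) +
       (\<Sum>j\<in>UNIV. (transpose (J (- X)) $ i $ j - (if i = j then transpose (J (- X)) $ 1 $ 1 + transpose (J (- X)) $ 2 $ 2 else 0)) * ev (g' j) Z))
       = (\<lambda>X. emb (act (theta X) g) (transpose Z))"
        unfolding emb_def act_eq dir_def sum_2 ev_simps ev_fields[OF Zt] J_def W_def g'_def pdiff_swap ev_swap
        by (simp add: fun_eq_iff vec_eq_iff forall_2 theta_def blk_def matrix_matrix_mult_def sum_2 transpose_def algebra_simps)
    qed
    from fun_cong[OF frechet_derivative_at[OF this], of X]
    have "differential pi_right X (emb g') Z = emb (act (theta X) g) (transpose Z)"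
      unfolding differential_def using Z by simp
    then show ?thesis
      unfolding differential_pi_left hswap_emb g'_def[symmetric] by (simp add: emb_def ev_swap)
  qed
qed

lemma irreducible_transport:
  assumes irr: "irreducible_lie_rep L \<rho> V" and L: "\<And>X. X \<in> L \<Longrightarrow> theta X \<in> L"
    and \<rho>': "\<And>X f. f \<in> V \<Longrightarrow> \<rho>' X (hswap f) = hswap (\<rho> (theta X) f)"
  shows "irreducible_lie_rep L \<rho>' (hswap ` V)"
proof -
  have rep: "lie_rep L \<rho> V" and V0: "V \<noteq> {0}"
    and irr': "\<And>W. hfun.subspace W \<Longrightarrow> W \<subseteq> V \<Longrightarrow> (\<forall>X\<in>L. \<forall>f\<in>W. \<rho> X f \<in> W) \<Longrightarrow> W = {0} \<or> W = V"
    using irr unfolding irreducible_lie_rep_def by simp_all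
  have V: "hfun.subspace V" and r: "\<And>X f. X \<in> L \<Longrightarrow> f \<in> V \<Longrightarrow> \<rho> X f \<in> V"
    "\<And>X f g. X \<in> L \<Longrightarrow> f \<in> V \<Longrightarrow> g \<in> V \<Longrightarrow> \<rho> X (f + g) = \<rho> X f + \<rho> X g"
    "\<And>X c f. X \<in> L \<Longrightarrow> f \<in> V \<Longrightarrow> \<rho> X (fscale c f) = fscale c (\<rho> X f)"
    "\<And>X Y f. X \<in> L \<Longrightarrow> Y \<in> L \<Longrightarrow> f \<in> V \<Longrightarrow> \<rho> (X + Y) f = \<rho> X f + \<rho> Y f"
    "\<And>c X f. X \<in> L \<Longrightarrow> f \<in> V \<Longrightarrow> \<rho> (msc c X) f = fscale c (\<rho> X f)"
    "\<And>X Y f. X \<in> L \<Longrightarrow> Y \<in> L \<Longrightarrow> f \<in> V \<Longrightarrow> \<rho> (X ** Y - Y ** X) f = \<rho> X (\<rho> Y f) - \<rho> Y (\<rho> X f)"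
    using rep unfolding lie_rep_def by simp_all
  interpret sw: module_hom fscale fscale hswap
    by unfold_locales (rule hswap_linear)+
  have zero: "hswap 0 = 0" by (rule sw.zero)
  note [simp] = hfun.subspace_add[OF V] hfun.subspace_scale[OF V]
  have rep': "lie_rep L \<rho>' (hswap ` V)"
    unfolding lie_rep_def ball_simps
  proof (intro conjI ballI allI)
    show "hfun.subspace (hswap ` V)" by (rule sw.subspace_image[OF V])
  qed (simp_all add: \<rho>' r L theta_linear theta_bracket hswap_linear[symmetric])
  have "hswap ` V \<noteq> {0}"
  proof
    assume "hswap ` V = {0}"
    then have "hswap ` hswap ` V = {0}" by (simp add: zero)
    then show False using V0 by (simp add: image_image)
  qed
  moreover have "W = {0} \<or> W = hswap ` V"
    if W: "hfun.subspace W" "W \<subseteq> hswap ` V" "\<forall>X\<in>L. \<forall>f\<in>W. \<rho>' X f \<in> W" for W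
  proof -
    have sub: "hswap ` W \<subseteq> V" using W(2) by (auto dest!: subsetD)
    have "\<rho> X f \<in> hswap ` W" if "X \<in> L" "f \<in> hswap ` W" for X f
    proof -
      have f: "f \<in> V" "hswap f \<in> W" using that(2) sub by auto
      have "\<rho>' (theta X) (hswap f) \<in> W" using W(3) L[OF that(1)] f(2) by simp
      then have "hswap (\<rho> X f) \<in> W" by (simp add: \<rho>'[OF f(1)] theta_theta)
      then show ?thesis by (intro image_eqI[of _ _ "hswap (\<rho> X f)"]) simp_all
    qed
    then have "hswap ` W = {0} \<or> hswap ` W = V"
      by (intro irr' sw.subspace_image[OF W(1)] sub) simp
    then have "hswap ` hswap ` W = hswap ` {0} \<or> hswap ` hswap ` W = hswap ` V" by (elim disjE) simp_all
    then show ?thesis by (simp add: image_image zero)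
  qed
  ultimately show ?thesis unfolding irreducible_lie_rep_def using rep' by simp
qed

lemma parts_emb:
  assumes "f \<in> nonneg_part U_left \<or> f \<in> neg_part U_left"
  shows "\<exists>g. f = emb g"
proof -
  have *: "\<exists>g. f = emb g" if "f \<in> hfun.span {f \<in> U_left. Q f}" for Q
  proof -
    have "hfun.span {f \<in> U_left. Q f} \<subseteq> range emb"
    proof (rule hfun.span_minimal)
      show "{f \<in> U_left. Q f} \<subseteq> range emb" unfolding U_left_emb by auto
      show "hfun.subspace (range emb)"
        by (rule hfun.subspaceI) (auto simp: image_iff emb_simps[symmetric])
    qed
    then show ?thesis using that by (auto simp: image_iff)
  qed
  show ?thesis
    using assms *[of "\<lambda>f. \<exists>d\<ge>0. homogeneous d f"] *[of "\<lambda>f. \<exists>d<0. homogeneous d f"]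
    unfolding nonneg_part_def neg_part_def by (elim disjE)
qed

theorem proposition33:
  shows "\<forall>L \<in> {sl, gl}.
      irreducible_lie_rep L (differential pi_left) (nonneg_part U_left) \<and>
      irreducible_lie_rep L (differential pi_left) (neg_part U_left) \<and>
      irreducible_lie_rep L (differential pi_right) (nonneg_part U_right) \<and>
      irreducible_lie_rep L (differential pi_right) (neg_part U_right)"
proof
  fix L :: "glh set" assume "L \<in> {sl, gl}"
  then have sl: "sl \<subseteq> L" and theta: "\<And>X. X \<in> L \<Longrightarrow> theta X \<in> L"
    using theta_sl by (auto simp: gl_def)
  have right: "differential pi_right X (hswap f) = hswap (differential pi_left (theta X) f)"
    if "f \<in> nonneg_part U_left \<or> f \<in> neg_part U_left" for X f
    using parts_emb[OF that] differential_pi_right by auto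
  show "irreducible_lie_rep L (differential pi_left) (nonneg_part U_left) \<and>
      irreducible_lie_rep L (differential pi_left) (neg_part U_left) \<and>
      irreducible_lie_rep L (differential pi_right) (nonneg_part U_right) \<and>
      irreducible_lie_rep L (differential pi_right) (neg_part U_right)"
    unfolding parts_hswap
    by (intro conjI left_nonneg left_neg irreducible_transport[where \<rho> = "differential pi_left"] sl theta right) simp_all
qed

end
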